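(* Let $r$ be a positive integer and let $k\ge 2r-1$ be an odd integer. For a fixed $i$ with $1\le i\le r$, we have $$\sum_{\substack{k_1+\cdots+k_r=k\\ k_i\ \text{odd},\ k_j\ \text{even}\ (\forall j\ne i)}}\zeta_{\mathcal{A}}^{(2)}(k_1,\ldots,k_r)=C_{k,r,i}\,\zeta_{\mathcal{A}}^{(2)}(k)\quad\text{in }\mathcal{A},$$ where the sum is over tuples of positive integers $(k_1,\ldots,k_r)$ satisfying the stated conditions, $s_i=\min\{i,r-i\}$, and $C_{k,r,i}$ is the rational number $$C_{k,r,i}=\frac{(-1)^{r-1}}{4^{r-1}}\binom{k-r}{r-1}\binom{r-1}{i-1}\prod_{j=0}^{s_i-1}\frac{k-2j}{k-2r+2+2j}.$$
   Context: Let $\mathcal{P}$ be the set of prime numbers and $\mathcal{A}=\prod_{p\in\mathcal{P}}\mathbb{Z}/p\mathbb{Z}\big/\bigoplus_{p\in\mathcal{P}}\mathbb{Z}/p\mathbb{Z}$, which is a $\mathbb{Q}$-algebra (elements are families indexed by primes, identified if they agree at all but finitely many primes). For a finite sequence (index) of positive integers $(k_1,\ldots,k_r)$, the level-two finite multiple zeta value is $$\zeta_{\mathcal{A}}^{(2)}(k_1,\ldots,k_r)=\left(\sum_{0<n_1<\cdots<n_r<p/2}\frac{1}{n_1^{k_1}\cdots n_r^{k_r}}\bmod p\right)_{p}\in\mathcal{A}.$$ An empty product is understood to be $1$. *)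

theory Defs
  imports Complex_Main "HOL-Number_Theory.Number_Theory"
begin

section \<open>The ring of residues modulo almost all primes\<close>

text \<open>
  An element of the ring \<open>\<A> = (\<Prod>\<^sub>p \<int>/p\<int>) / (\<Oplus>\<^sub>p \<int>/p\<int>)\<close> is represented by a family of integers
  of which only the entries at prime indices, taken modulo that index, are relevant; two families
  represent the same element iff their residues agree at all but finitely many primes.
\<close>

definition cong_almost_all_primes :: "(nat \<Rightarrow> int) \<Rightarrow> (nat \<Rightarrow> int) \<Rightarrow> bool" where
  "cong_almost_all_primes f g \<longleftrightarrow> finite {p. prime p \<and> \<not> [f p = g p] (mod int p)}"

lemma cong_almost_all_primesI:
  assumes "finite {p. prime p \<and> \<not> P p}"
    and "\<And>p. prime p \<Longrightarrow> P p \<Longrightarrow> [f p = g p] (mod int p)"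
  shows "cong_almost_all_primes f g"
  unfolding cong_almost_all_primes_def by (rule finite_subset[OF _ assms(1)]) (use assms(2) in auto)

lemma cong_almost_all_primesI2:
  assumes "cong_almost_all_primes f f'" "cong_almost_all_primes g g'"
    and "\<And>p. prime p \<Longrightarrow> [f p = f' p] (mod int p) \<Longrightarrow> [g p = g' p] (mod int p)
           \<Longrightarrow> [h p = h' p] (mod int p)"
  shows "cong_almost_all_primes h h'"
proof (rule cong_almost_all_primesI)
  have "{p. prime p \<and> \<not> ([f p = f' p] (mod int p) \<and> [g p = g' p] (mod int p))} =
        {p. prime p \<and> \<not> [f p = f' p] (mod int p)} \<union> {p. prime p \<and> \<not> [g p = g' p] (mod int p)}"
    by auto
  then show "finite {p. prime p \<and> \<not> ([f p = f' p] (mod int p) \<and> [g p = g' p] (mod int p))}"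
    using assms(1,2) by (simp add: cong_almost_all_primes_def)
qed (use assms(3) in auto)

lemma cong_almost_all_primes_refl: "cong_almost_all_primes f f"
  by (simp add: cong_almost_all_primes_def)

lemma equivp_cong_almost_all_primes: "equivp cong_almost_all_primes"
proof (rule equivpI)
  show "reflp cong_almost_all_primes"
    by (simp add: reflp_def cong_almost_all_primes_refl)
  show "symp cong_almost_all_primes"
    by (simp add: symp_def cong_almost_all_primes_def cong_sym_eq)
  show "transp cong_almost_all_primes"
    by (rule transpI, erule (1) cong_almost_all_primesI2) (blast intro: cong_trans)
qed

quotient_type ring_A = "nat \<Rightarrow> int" / cong_almost_all_primes
  by (rule equivp_cong_almost_all_primes)

instantiation ring_A :: comm_ring_1
begin

lift_definition zero_ring_A :: ring_A is "\<lambda>_. 0" .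
lift_definition one_ring_A :: ring_A is "\<lambda>_. 1" .
lift_definition plus_ring_A :: "ring_A \<Rightarrow> ring_A \<Rightarrow> ring_A" is "\<lambda>f g p. f p + g p"
  by (erule (1) cong_almost_all_primesI2) (rule cong_add)
lift_definition times_ring_A :: "ring_A \<Rightarrow> ring_A \<Rightarrow> ring_A" is "\<lambda>f g p. f p * g p"
  by (erule (1) cong_almost_all_primesI2) (rule cong_mult)
lift_definition minus_ring_A :: "ring_A \<Rightarrow> ring_A \<Rightarrow> ring_A" is "\<lambda>f g p. f p - g p"
  by (erule (1) cong_almost_all_primesI2) (rule cong_diff)
lift_definition uminus_ring_A :: "ring_A \<Rightarrow> ring_A" is "\<lambda>f p. - f p"
  by (simp add: cong_almost_all_primes_def cong_minus_minus_iff)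

instance
proof
  show "(0 :: ring_A) \<noteq> 1"
  proof (transfer, unfold cong_almost_all_primes_def)
    have "{p::nat. prime p \<and> \<not> [0 = 1] (mod int p)} = {p. prime p}"
      by (auto simp: cong_def prime_gt_1_nat)
    then show "infinite {p::nat. prime p \<and> \<not> [0 = 1] (mod int p)}"
      using primes_infinite by simp
  qed
qed (transfer, simp add: cong_almost_all_primes_refl algebra_simps)+

end

subsection \<open>Reduction of rational numbers and the algebra structure over the rationals\<close>

text \<open>
  The reduction \<open>q mod p\<close> is meaningful if \<open>p\<close> does not divide the denominator of \<open>q\<close>.
\<close>

definition residue_rat :: "nat \<Rightarrow> rat \<Rightarrow> int" where
  "residue_rat p q =
     (let (a, b) = quotient_of q in a * modular_inverse (int p) b mod int p)"

definition integral_at :: "nat \<Rightarrow> rat \<Rightarrow> bool" where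
  "integral_at p q \<longleftrightarrow> \<not> int p dvd snd (quotient_of q)"

lemma integral_at_fraction:
  assumes p: "prime p" and b: "\<not> int p dvd b" and q: "q * of_int b = of_int a"
  shows "integral_at p q" and "[b * residue_rat p q = a] (mod int p)"
proof -
  obtain n d where nd: "quotient_of q = (n, d)" by force
  have d: "d > 0" "coprime n d" "q = of_int n / of_int d"
    using nd quotient_of_denom_pos quotient_of_coprime quotient_of_div by blast+
  have "(of_int (n * b) :: rat) = of_int (a * d)"
    using q d by (simp add: field_simps)
  then have nb: "n * b = a * d" by (simp only: of_int_eq_iff)
  then have "d dvd b" using d(2) by (metis coprime_commute coprime_dvd_mult_right_iff dvd_triv_right)
  then obtain m where m: "b = d * m" by blast
  have a: "a = n * m" using nb d(1) m by simp
  have pd: "\<not> int p dvd d" using b m by auto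
  then show "integral_at p q" by (simp add: integral_at_def nd)
  have "coprime d (int p)"
    using p pd by (metis coprime_commute prime_imp_coprime prime_nat_int_transfer)
  then have "[d * modular_inverse (int p) d = 1] (mod int p)" by (rule cong_modular_inverse1)
  then have "[m * n * (d * modular_inverse (int p) d) = m * n * 1] (mod int p)"
    by (rule cong_scalar_left)
  moreover have "[b * residue_rat p q = m * n * (d * modular_inverse (int p) d)] (mod int p)"
  proof -
    have "[b * (n * modular_inverse (int p) d mod int p) = b * (n * modular_inverse (int p) d)] (mod int p)"
      by (intro cong_mult cong_refl) (simp add: cong_def)
    then show ?thesis by (simp add: residue_rat_def nd m mult_ac)
  qed
  ultimately show "[b * residue_rat p q = a] (mod int p)"
    by (metis a cong_trans mult.commute mult.right_neutral)
qed

lemma residue_rat_eqI: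
  assumes p: "prime p" and b: "\<not> int p dvd b" and q: "q * of_int b = of_int a"
    and x: "[b * x = a] (mod int p)"
  shows "[residue_rat p q = x] (mod int p)"
proof -
  have "coprime b (int p)"
    using p b by (metis coprime_commute prime_imp_coprime prime_nat_int_transfer)
  moreover have "[b * residue_rat p q = b * x] (mod int p)"
    using integral_at_fraction(2)[OF p b q] x by (metis cong_sym cong_trans)
  ultimately show ?thesis by (simp add: cong_mult_lcancel)
qed

lemma integral_atE:
  assumes "prime p" "integral_at p q"
  obtains a b where "\<not> int p dvd b" "q * of_int b = of_int a"
    "[b * residue_rat p q = a] (mod int p)"
proof -
  obtain n d where nd: "quotient_of q = (n, d)" by force
  have "d > 0" "q = of_int n / of_int d"
    using nd quotient_of_denom_pos quotient_of_div by blast+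
  then have *: "q * of_int d = of_int n" by simp
  have **: "\<not> int p dvd d" using assms by (simp add: integral_at_def nd)
  show ?thesis using that[OF ** * integral_at_fraction(2)[OF assms(1) ** *]] .
qed

lemma residue_rat_of_int [simp]: "prime p \<Longrightarrow> [residue_rat p (of_int a) = a] (mod int p)"
  by (rule residue_rat_eqI[where b = 1 and a = a]) auto

lemma integral_at_of_int [simp]: "prime p \<Longrightarrow> integral_at p (of_int a)"
  by (rule integral_at_fraction(1)[where b = 1 and a = a]) auto

lemma integral_at_add_mult:
  assumes p: "prime p" and x: "integral_at p x" and y: "integral_at p y"
  shows "integral_at p (x + y)"
    and "[residue_rat p (x + y) = residue_rat p x + residue_rat p y] (mod int p)"
    and "integral_at p (x * y)"
    and "[residue_rat p (x * y) = residue_rat p x * residue_rat p y] (mod int p)"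
proof -
  obtain a b where ab: "\<not> int p dvd b" "x * of_int b = of_int a"
    "[b * residue_rat p x = a] (mod int p)" using p x by (rule integral_atE)
  obtain c d where cd: "\<not> int p dvd d" "y * of_int d = of_int c"
    "[d * residue_rat p y = c] (mod int p)" using p y by (rule integral_atE)
  have bd: "\<not> int p dvd b * d" using ab(1) cd(1) p by (simp add: prime_dvd_mult_iff)
  have "(x + y) * of_int (b * d) = (x * of_int b) * of_int d + (y * of_int d) * of_int b"
    by (simp add: algebra_simps)
  then have 1: "(x + y) * of_int (b * d) = of_int (a * d + c * b)"
    by (simp only: ab(2) cd(2) of_int_mult of_int_add)
  have "(x * y) * of_int (b * d) = (x * of_int b) * (y * of_int d)"
    by simp
  then have 2: "(x * y) * of_int (b * d) = of_int (a * c)"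
    by (simp only: ab(2) cd(2) of_int_mult)
  show "integral_at p (x + y)" using p bd 1 by (rule integral_at_fraction)
  show "integral_at p (x * y)" using p bd 2 by (rule integral_at_fraction)
  have "[(b * residue_rat p x) * d + (d * residue_rat p y) * b = a * d + c * b] (mod int p)"
    by (intro cong_add cong_mult ab cd cong_refl)
  then have "[b * d * (residue_rat p x + residue_rat p y) = a * d + c * b] (mod int p)"
    by (simp add: algebra_simps)
  then show "[residue_rat p (x + y) = residue_rat p x + residue_rat p y] (mod int p)"
    by (rule residue_rat_eqI[OF p bd 1])
  have "[(b * residue_rat p x) * (d * residue_rat p y) = a * c] (mod int p)"
    by (intro cong_mult ab cd)
  then have "[b * d * (residue_rat p x * residue_rat p y) = a * c] (mod int p)"
    by (simp add: mult_ac)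
  then show "[residue_rat p (x * y) = residue_rat p x * residue_rat p y] (mod int p)"
    by (rule residue_rat_eqI[OF p bd 2])
qed

lemma integral_at_sum:
  assumes "prime p" "\<And>x. x \<in> S \<Longrightarrow> integral_at p (f x)"
  shows "integral_at p (sum f S) \<and>
    [residue_rat p (sum f S) = (\<Sum>x\<in>S. residue_rat p (f x))] (mod int p)"
  using assms(2)
proof (induction S rule: infinite_finite_induct)
  case (insert s S)
  then have 1: "integral_at p (f s)" and 2: "integral_at p (sum f S)"
    and 3: "[residue_rat p (sum f S) = (\<Sum>x\<in>S. residue_rat p (f x))] (mod int p)" by auto
  have "[residue_rat p (f s + sum f S)
      = residue_rat p (f s) + (\<Sum>x\<in>S. residue_rat p (f x))] (mod int p)"
    using integral_at_add_mult(2)[OF assms(1) 1 2] by (rule cong_trans) (intro cong_add cong_refl 3)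
  then show ?case using insert.hyps integral_at_add_mult(1)[OF assms(1) 1 2] by simp
next
  case (infinite S)
  then show ?case
    using residue_rat_of_int[OF assms(1), of 0] integral_at_of_int[OF assms(1), of 0] by simp
next
  case empty
  then show ?case
    using residue_rat_of_int[OF assms(1), of 0] integral_at_of_int[OF assms(1), of 0] by simp
qed

lemma finite_not_integral_at: "finite {p. \<not> integral_at p q}"
proof -
  have "snd (quotient_of q) \<noteq> 0" using quotient_of_denom_pos'[of q] by simp
  then have "finite (int -` {d. d dvd snd (quotient_of q)})"
    by (intro finite_vimageI finite_divisors_int) auto
  then show ?thesis by (simp add: integral_at_def vimage_def)
qed

text \<open>
  The structure map \<open>\<rat> \<rightarrow> \<A>\<close>. The library function \<open>of_rat\<close> is not available, since \<open>\<A>\<close> is not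
  a field.
\<close>

lift_definition rat_A :: "rat \<Rightarrow> ring_A" is "\<lambda>q p. residue_rat p q" .

lemma rat_A_of_int: "rat_A (of_int a) = of_int a"
proof -
  have *: "of_int a = abs_ring_A (\<lambda>_. a)"
  proof (induction a rule: int_induct[where k = 0])
    case base
    show ?case by (simp add: zero_ring_A_def)
  next
    case (step1 i)
    then show ?case by (simp add: one_ring_A_def plus_ring_A.abs_eq cong_almost_all_primes_refl)
  next
    case (step2 i)
    then show ?case by (simp add: one_ring_A_def minus_ring_A.abs_eq cong_almost_all_primes_refl)
  qed
  show ?thesis unfolding *
    by transfer (rule cong_almost_all_primesI[where P = "\<lambda>_. True"], simp_all)
qed

lemma rat_A_0 [simp]: "rat_A 0 = 0" and rat_A_1 [simp]: "rat_A 1 = 1"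
  using rat_A_of_int[of 0] rat_A_of_int[of 1] by simp_all

lemma rat_A_add: "rat_A (x + y) = rat_A x + rat_A y"
  and rat_A_mult: "rat_A (x * y) = rat_A x * rat_A y"
proof -
  have fin: "finite {p. prime p \<and> \<not> (integral_at p x \<and> integral_at p y)}"
    by (rule finite_subset[of _ "{p. \<not> integral_at p x} \<union> {p. \<not> integral_at p y}"])
       (auto simp: finite_not_integral_at)
  show "rat_A (x + y) = rat_A x + rat_A y"
    using fin by transfer (erule cong_almost_all_primesI, blast intro: integral_at_add_mult)
  show "rat_A (x * y) = rat_A x * rat_A y"
    using fin by transfer (erule cong_almost_all_primesI, blast intro: integral_at_add_mult)
qed

interpretation ring_A: vector_space "\<lambda>q x. rat_A q * x"
  by unfold_locales (simp_all add: rat_A_add rat_A_mult algebra_simps)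

section \<open>Finite multiple zeta values of level two\<close>

text \<open>The tuples \<open>0 < n\<^sub>1 < \<dots> < n\<^sub>r < p/2\<close>.\<close>

definition half_chains :: "nat \<Rightarrow> nat \<Rightarrow> nat list set" where
  "half_chains p r =
     {ns. length ns = r \<and> sorted_wrt (<) ns \<and> (\<forall>n\<in>set ns. 0 < n \<and> 2 * n < p)}"

definition half_harmonic_sum :: "nat \<Rightarrow> nat list \<Rightarrow> rat" where
  "half_harmonic_sum p ks =
     (\<Sum>ns\<in>half_chains p (length ks). 1 / (\<Prod>j<length ks. of_nat (ns ! j) ^ (ks ! j)))"

lift_definition zeta_A2 :: "nat list \<Rightarrow> ring_A" is
  "\<lambda>ks p. residue_rat p (half_harmonic_sum p ks)" .

lemma finite_half_chains: "finite (half_chains p r)"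
  by (rule finite_subset[OF _ finite_lists_length_eq[of "{..p}" r]]) (auto simp: half_chains_def)

lemma half_chains_not_dvd:
  assumes "prime p" "ns \<in> half_chains p (length ks)"
  shows "\<not> int p dvd (\<Prod>j<length ks. int (ns ! j) ^ (ks ! j))"
proof
  assume "int p dvd (\<Prod>j<length ks. int (ns ! j) ^ (ks ! j))"
  then obtain j where j: "j < length ks" "int p dvd int (ns ! j) ^ (ks ! j)"
    using assms(1) by (auto simp: prime_dvd_prod_iff)
  then have "p dvd ns ! j" using assms(1) by (metis int_dvd_int_iff prime_dvd_power prime_nat_int_transfer)
  moreover have "0 < ns ! j" "2 * ns ! j < p"
    using assms(2) j(1) by (auto simp: half_chains_def)
  ultimately show False by (auto dest: dvd_imp_le)
qed

text \<open>
  Reducing the rational number \<^const>\<open>half_harmonic_sum\<close> modulo \<open>p\<close> is the same as computing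
  the sum in \<open>\<int>/p\<int>\<close>.
\<close>

lemma residue_half_harmonic_sum:
  assumes "prime p"
  shows "integral_at p (half_harmonic_sum p ks)"
    and "[residue_rat p (half_harmonic_sum p ks) =
      (\<Sum>ns\<in>half_chains p (length ks).
         modular_inverse (int p) (\<Prod>j<length ks. int (ns ! j) ^ (ks ! j)))] (mod int p)"
proof -
  define P where "P ns = (\<Prod>j<length ks. int (ns ! j) ^ (ks ! j))" for ns
  have eq: "half_harmonic_sum p ks = (\<Sum>ns\<in>half_chains p (length ks). 1 / of_int (P ns))"
    by (simp add: half_harmonic_sum_def P_def)
  have *: "integral_at p (1 / of_int (P ns))"
    "[residue_rat p (1 / of_int (P ns)) = modular_inverse (int p) (P ns)] (mod int p)"
    if "ns \<in> half_chains p (length ks)" for ns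
  proof -
    have nd: "\<not> int p dvd P ns" using half_chains_not_dvd[OF assms that] by (simp add: P_def)
    then have "P ns \<noteq> 0" by auto
    then have q: "1 / of_int (P ns) * of_int (P ns) = (of_int 1 :: rat)" by simp
    show "integral_at p (1 / of_int (P ns))" using assms nd q by (rule integral_at_fraction)
    have "coprime (P ns) (int p)"
      using assms nd by (metis coprime_commute prime_imp_coprime prime_nat_int_transfer)
    then have "[P ns * modular_inverse (int p) (P ns) = 1] (mod int p)"
      by (rule cong_modular_inverse1)
    then show "[residue_rat p (1 / of_int (P ns)) = modular_inverse (int p) (P ns)] (mod int p)"
      by (rule residue_rat_eqI[OF assms nd q])
  qed
  have s: "integral_at p (half_harmonic_sum p ks) \<and>
      [residue_rat p (half_harmonic_sum p ks) =
       (\<Sum>ns\<in>half_chains p (length ks). residue_rat p (1 / of_int (P ns)))] (mod int p)"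
    unfolding eq by (rule integral_at_sum) (fact assms, fact *(1))
  then show "integral_at p (half_harmonic_sum p ks)" by (rule conjunct1)
  have "[(\<Sum>ns\<in>half_chains p (length ks). residue_rat p (1 / of_int (P ns))) =
         (\<Sum>ns\<in>half_chains p (length ks). modular_inverse (int p) (P ns))] (mod int p)"
    by (intro cong_sum *(2))
  from cong_trans[OF conjunct2[OF s] this]
  show "[residue_rat p (half_harmonic_sum p ks) =
      (\<Sum>ns\<in>half_chains p (length ks).
         modular_inverse (int p) (\<Prod>j<length ks. int (ns ! j) ^ (ks ! j)))] (mod int p)"
    unfolding P_def .
qed

section \<open>The index set and the constant\<close>

text \<open>Positions are numbered from \<open>1\<close>: the entry \<open>k\<^sub>j\<close> of an index is \<open>ks ! (j - 1)\<close>.\<close>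

definition one_odd_indices :: "nat \<Rightarrow> nat \<Rightarrow> nat \<Rightarrow> nat list set" where
  "one_odd_indices k r i =
     {ks. length ks = r \<and> (\<forall>x\<in>set ks. 0 < x) \<and> sum_list ks = k \<and>
          odd (ks ! (i - 1)) \<and> (\<forall>j\<in>{1..r}. j \<noteq> i \<longrightarrow> even (ks ! (j - 1)))}"

lemma finite_one_odd_indices: "finite (one_odd_indices k r i)"
  by (rule finite_subset[OF _ finite_lists_length_eq[of "{..k}" r]])
     (auto simp: one_odd_indices_def member_le_sum_list)

definition C_const :: "nat \<Rightarrow> nat \<Rightarrow> nat \<Rightarrow> rat" where
  "C_const k r i =
     (- 1) ^ (r - 1) / 4 ^ (r - 1) * of_nat ((k - r) choose (r - 1)) * of_nat ((r - 1) choose (i - 1)) *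
     (\<Prod>j<min i (r - i).
        (of_nat k - 2 * of_nat j) / (of_nat k - 2 * of_nat r + 2 + 2 * of_nat j))"

end

theory Submission
  imports Defs "HOL-Computational_Algebra.Polynomial_FPS"
begin

text \<open>
  Fix a prime \<open>p = 2N + 1\<close>, write \<open>k = 2M + 1\<close>, \<open>\<alpha> = i - 1\<close>, \<open>\<beta> = r - i\<close>, and compute modulo
  \<open>p\<close>. Three ideas give the identity for every \<open>p\<close> with \<open>M < N\<close>, hence for almost all \<open>p\<close>.

  \<^emph>\<open>Removing the geometric series.\<close> The generating series in \<open>X\<close> (with \<open>X\<^sup>M\<close> marking weight
  \<open>2M + 1\<close>) of the left hand side is the sum over \<open>n \<le> N\<close> of \<open>(1/n) / (1 - X/n\<^sup>2)\<close> times the elementary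
  symmetric functions of degrees \<open>\<alpha>\<close> and \<open>\<beta>\<close> of the series \<open>(X/m\<^sup>2) / (1 - X/m\<^sup>2)\<close>, taken over \<open>m < n\<close> and
  over \<open>m > n\<close>. The product of all denominators is \<open>1 - X\<^sup>N\<close>, because \<open>1\<^sup>2, \<dots>, N\<^sup>2\<close> are the roots of
  \<open>X\<^sup>N - 1\<close> modulo \<open>p\<close> (\<open>coeff_recip_poly_full\<close>). So below degree \<open>N\<close> one may multiply by it, and the
  left hand side becomes a combination with binomial coefficients of the numbers
  \<open>Z(u,v) = (-1)\<^sup>u\<^sup>+\<^sup>v \<zeta>({2}\<^sup>u, 1, {2}\<^sup>v)\<close> with \<open>u + v = M\<close> (\<open>sum_one_odd_cong\<close>), where \<open>\<zeta>\<close> stands for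
  the sum over \<open>n\<^sub>1 < \<dots> < n\<^sub>r < p/2\<close> modulo \<open>p\<close>.

  \<^emph>\<open>Evaluating \<open>Z(u,v)\<close> by interpolation.\<close> The key congruence (\<open>mixed_sum_cong\<close>) is
  \<open>4\<^sup>M Z(u,v) = binomial(2M + 1, 2v) \<zeta>(2M + 1)\<close>. Collected in one generating polynomial, it says that
  the sum over \<open>n\<close> of \<open>(a/n) \<Prod>\<^sub>m\<^sub><\<^sub>n (1 - a\<^sup>2/m\<^sup>2) \<Prod>\<^sub>m\<^sub>>\<^sub>n (1 - b\<^sup>2/m\<^sup>2)\<close> equals \<open>f(a + b) + f(a - b)\<close>, where
  \<open>f(c)\<close> is the sum of \<open>\<zeta>(j) (c/2)\<^sup>j\<close> over odd \<open>j < p - 1\<close>. After division by \<open>a\<close> both sides have degree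
  less than \<open>N\<close> in \<open>a\<^sup>2\<close> and in \<open>b\<^sup>2\<close>, so it suffices to compare them for \<open>a, b = 1, \<dots>, N\<close>. There
  both equal \<open>- (-1)\<^sup>a\<^sup>+\<^sup>b (1 + sgn (a - b)) / 2\<close>: on the left only \<open>b \<le> n \<le> a\<close> contribute and what remains is
  an alternating binomial sum (\<open>two_parameter_sum\<close>); on the right \<open>f\<close> is a sum of geometric
  progressions, each of which vanishes unless \<open>c = \<plusminus>2n\<close> modulo \<open>p\<close> (\<open>odd_zeta_poly_at_nat\<close>).

  \<^emph>\<open>The constant.\<close> It remains to sum \<open>binomial(u, \<alpha>) binomial(v, \<beta>) binomial(2M + 1, 2v)\<close> over
  \<open>u + v = M\<close>. Splitting the last factor into rising factorials of \<open>1/2\<close> and \<open>3/2\<close> turns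
  this into a Vandermonde convolution (\<open>C_const_eq_sum\<close>).
\<close>

unbundle fps_syntax

section \<open>An exact evaluation of a two-parameter sum\<close>

text \<open>By Pascal's rule an iterated difference of order \<open>D + 1\<close> is one of order \<open>D\<close> of differences.\<close>
lemma alternating_binomial_sum_Suc:
  fixes F :: "nat \<Rightarrow> int"
  shows "(\<Sum>j\<le>Suc D. (-1) ^ j * int (Suc D choose j) * F j) =
    (\<Sum>j\<le>D. (-1) ^ j * int (D choose j) * (F j - F (Suc j)))"
proof -
  have "(\<Sum>j\<le>D. (-1) ^ j * int (D choose j) * F j) = (\<Sum>j\<le>Suc D. (-1) ^ j * int (D choose j) * F j)"
    by simp
  also have "\<dots> = F 0 + (\<Sum>j\<le>D. (-1) ^ Suc j * int (D choose Suc j) * F (Suc j))"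
    by (subst sum.atMost_Suc_shift) simp
  finally have "(\<Sum>j\<le>D. (-1) ^ j * int (D choose j) * F j) =
    F 0 + (\<Sum>j\<le>D. (-1) ^ Suc j * int (D choose Suc j) * F (Suc j))" .
  then show ?thesis
    by (subst sum.atMost_Suc_shift) (simp add: algebra_simps sum_subtractf sum.distrib sum_negf)
qed

text \<open>
  Up to sign, the left hand side is the \<open>D\<close>-th difference of a polynomial of degree \<open>D\<close> with leading
  coefficient \<open>1 / D!\<close>.
\<close>
lemma alternating_choose_sum:
  "(\<Sum>j\<le>D. (-1) ^ j * int (D choose j) * int ((x + j) choose D)) = (-1) ^ D"
proof (induction D)
  case (Suc D)
  have "int ((x + j) choose Suc D) - int ((x + Suc j) choose Suc D) = - int ((x + j) choose D)" for j
    by simp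
  then have "(\<Sum>j\<le>Suc D. (-1) ^ j * int (Suc D choose j) * int ((x + j) choose Suc D))
      = (\<Sum>j\<le>D. (-1) ^ j * int (D choose j) * (- int ((x + j) choose D)))"
    unfolding alternating_binomial_sum_Suc by simp
  also have "\<dots> = - ((-1) ^ D)"
    unfolding Suc.IH[symmetric] by (simp add: sum_negf)
  finally show ?case by simp
qed simp

lemma prod_square_diff_below:
  assumes "1 \<le> n" "n \<le> a"
  shows "int a * fact (a - n) * (\<Prod>m\<in>{1..<n}. (int m)\<^sup>2 - (int a)\<^sup>2) = (-1) ^ (n - 1) * fact (a + n - 1)"
  using assms
proof (induction n rule: nat_induct_at_least)
  case base
  then show ?case by (cases a) auto
next
  case (Suc n)
  obtain d where d: "a = n + Suc d" using Suc.prems less_imp_Suc_add[of n a] by auto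
  obtain m where m: "n = Suc m" using Suc.hyps by (cases n) auto
  let ?P = "\<Prod>m\<in>{1..<n}. (int m)\<^sup>2 - (int a)\<^sup>2"
  have sq: "(int n)\<^sup>2 - (int a)\<^sup>2 = - (int (Suc d) * int (a + n))"
    unfolding d by (simp add: power2_eq_square algebra_simps)
  have "int a * fact d * (?P * ((int n)\<^sup>2 - (int a)\<^sup>2))
      = - (int a * (int (Suc d) * fact d) * ?P) * int (a + n)"
    unfolding sq by (simp only: mult_ac mult_minus_right mult_minus_left)
  also have "\<dots> = - (int a * fact (a - n) * ?P) * int (a + n)"
    unfolding d by simp
  also have "\<dots> = - ((-1) ^ (n - 1) * fact (a + n - 1)) * int (a + n)"
    using Suc by simp
  also have "\<dots> = (-1) ^ n * fact (a + n)"
    unfolding m by (simp add: algebra_simps)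
  finally show ?case using d by simp
qed

lemma prod_square_diff_above:
  assumes "n \<le> N" "b \<le> n"
  shows "fact (n - b) * fact (n + b) * (\<Prod>m\<in>{n<..N}. (int m)\<^sup>2 - (int b)\<^sup>2) = (fact (N - b) * fact (N + b) :: int)"
  using assms(1)
proof (induction N rule: dec_induct)
  case base
  then show ?case by simp
next
  case (step N)
  obtain d where d: "N = b + d" using step assms le_Suc_ex by (metis le_trans)
  have *: "{n<..Suc N} = insert (Suc N) {n<..N}" using step by auto
  have "fact (n - b) * fact (n + b) * (\<Prod>m\<in>{n<..Suc N}. (int m)\<^sup>2 - (int b)\<^sup>2)
      = ((int (Suc N))\<^sup>2 - (int b)\<^sup>2) * (fact (N - b) * fact (N + b))"
    unfolding * step.IH[symmetric] by (simp add: algebra_simps)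
  also have "\<dots> = fact (Suc N - b) * fact (Suc N + b)"
    unfolding d by (simp add: power2_eq_square algebra_simps Suc_diff_le)
  finally show ?case .
qed

lemma int_choose_fact: "int ((x + y) choose x) * fact x * fact y = fact (x + y)"
proof -
  have "fact x * fact y * ((x + y) choose x) = (fact (x + y) :: nat)"
    using binomial_fact_lemma[of x "x + y"] by simp
  then have "int (fact x * fact y * ((x + y) choose x)) = int (fact (x + y))"
    by (rule arg_cong)
  then show ?thesis by (simp only: of_nat_mult of_nat_fact mult_ac)
qed

text \<open>
  The factor \<open>2n\<close> is split as \<open>(n - b) + (n + b)\<close>; each part cancels against one of the factorials
  \<open>(n - b)!\<close>, \<open>(n + b)!\<close> and leaves a product of two binomial coefficients of the form summed in
  \<open>alternating_choose_sum\<close>. For \<open>n = b\<close> the first part vanishes, which truncated subtraction would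
  not reproduce; hence the case distinction.
\<close>
lemma factorials_eq_two_binomials:
  assumes "1 \<le> b" "b \<le> n" "n \<le> a"
  shows "2 * int n * fact (a + n - 1) =
    ((if b < n then int ((a + n - 1) choose (a - b - 1)) * int ((a - b - 1) choose (n - b - 1)) else 0)
     + int ((a + n - 1) choose (a - b)) * int ((a - b) choose (n - b)))
    * (fact (a - n) * fact (n - b) * fact (n + b))"
proof -
  obtain j where j: "n = b + j" using assms(2) le_Suc_ex by blast
  obtain t where t: "a = b + j + t" using assms(3) le_Suc_ex j by blast
  obtain c where c: "b = Suc c" using assms(1) by (cases b) auto
  have e1: "j + t + (2 * b + j - 1) = 2 * b + 2 * j + t - 1" using c by simp
  have 1: "int ((2 * b + 2 * j + t - 1) choose (j + t)) * fact (j + t) * fact (2 * b + j - 1)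
         = (fact (2 * b + 2 * j + t - 1) :: int)"
    using int_choose_fact[of "j + t" "2 * b + j - 1"] unfolding e1 .
  have 2: "int ((j + t) choose j) * fact t * fact j = (fact (j + t) :: int)"
    using int_choose_fact[of j t] by (simp only: mult_ac)
  have 3: "fact (2 * b + j) = int (2 * b + j) * fact (2 * b + j - 1)"
    using c by simp
  have A: "int ((a + n - 1) choose (a - b)) * int ((a - b) choose (n - b))
     * (fact (a - n) * fact (n - b) * fact (n + b)) = int (2 * b + j) * fact (a + n - 1)"
  proof -
    have e: "a + n - 1 = 2 * b + 2 * j + t - 1" "a - b = j + t" "n - b = j" "a - n = t" "n + b = 2 * b + j"
      using j t by auto
    show ?thesis unfolding e 3 1[symmetric] 2[symmetric] by (simp only: mult_ac)
  qed
  have B: "(if b < n then int ((a + n - 1) choose (a - b - 1)) * int ((a - b - 1) choose (n - b - 1)) else 0)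
     * (fact (a - n) * fact (n - b) * fact (n + b)) = int j * fact (a + n - 1)"
  proof (cases j)
    case 0
    then show ?thesis using j by simp
  next
    case (Suc i)
    have e2: "i + t + (2 * b + j) = 2 * b + 2 * j + t - 1" using Suc by simp
    have 1: "int ((2 * b + 2 * j + t - 1) choose (i + t)) * fact (i + t) * fact (2 * b + j)
         = (fact (2 * b + 2 * j + t - 1) :: int)"
      using int_choose_fact[of "i + t" "2 * b + j"] unfolding e2 .
    have 2: "int ((i + t) choose i) * fact t * fact i = (fact (i + t) :: int)"
      using int_choose_fact[of i t] by (simp only: mult_ac)
    have 3: "fact j = int j * fact i" using Suc by simp
    have e: "a + n - 1 = 2 * b + 2 * j + t - 1" "a - b - 1 = i + t" "n - b = j" "j - 1 = i" "a - n = t" "n + b = 2 * b + j"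
      using j t Suc by auto
    have bn: "b < n" using j Suc by simp
    show ?thesis unfolding e if_P[OF bn] 3 1[symmetric] 2[symmetric] by (simp only: mult_ac)
  qed
  have "2 * int n * fact (a + n - 1) = int j * fact (a + n - 1) + int (2 * b + j) * fact (a + n - 1)"
    using j by (simp add: algebra_simps)
  then show ?thesis unfolding A[symmetric] B[symmetric] by (simp only: distrib_right)
qed

text \<open>
  The first product vanishes for \<open>n > a\<close> and the second for \<open>n < b\<close>. In the remaining range \<open>2a\<close> times
  the summand is \<open>- (-1)\<^sup>n (N - b)! (N + b)!\<close> times the sum of the two binomial products of
  \<open>factorials_eq_two_binomials\<close>. Summed with the sign \<open>(-1)\<^sup>n\<close>, the second product gives \<open>(-1)\<^sup>a\<close> for
  \<open>b \<le> a\<close> and the first one only for \<open>b < a\<close>, whence the factor \<open>1 + sgn (a - b)\<close>.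
\<close>
lemma two_parameter_sum:
  assumes a: "1 \<le> a" "a \<le> N" and b: "1 \<le> b" "b \<le> N"
  shows "2 * int a * (\<Sum>n=1..N. int n * (\<Prod>m\<in>{1..<n}. (int m)\<^sup>2 - (int a)\<^sup>2) *
                       (\<Prod>m\<in>{n<..N}. (int m)\<^sup>2 - (int b)\<^sup>2))
       = - ((-1) ^ a * (1 + sgn (int a - int b)) * (fact (N - b) * fact (N + b)))"
proof -
  define P Q where "P n = (\<Prod>m\<in>{1..<n}. (int m)\<^sup>2 - (int a)\<^sup>2)"
    and "Q n = (\<Prod>m\<in>{n<..N}. (int m)\<^sup>2 - (int b)\<^sup>2)" for n
  define F :: int where "F = fact (N - b) * fact (N + b)"
  define c1 c2 where "c1 n = (if b < n then int ((a + n - 1) choose (a - b - 1)) * int ((a - b - 1) choose (n - b - 1)) else 0)"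
    and "c2 n = int ((a + n - 1) choose (a - b)) * int ((a - b) choose (n - b))" for n
  have zero: "P n * Q n = 0" if "n \<in> {1..N}" "n \<notin> {b..a}" for n
  proof (cases "n < b")
    case True
    then have "Q n = 0" unfolding Q_def by (intro prod_zero) (use b in auto)
    then show ?thesis by simp
  next
    case False
    then have "P n = 0" unfolding P_def by (intro prod_zero) (use a that in auto)
    then show ?thesis by simp
  qed
  have summand: "2 * int a * (int n * P n * Q n) = - (F * ((-1) ^ n * c1 n + (-1) ^ n * c2 n))" if n: "n \<in> {b..a}" for n
  proof -
    have 1: "int a * fact (a - n) * P n = (-1) ^ (n - 1) * fact (a + n - 1)"
      unfolding P_def by (rule prod_square_diff_below) (use n b in auto)
    have 2: "fact (n - b) * fact (n + b) * Q n = F"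
      unfolding Q_def F_def by (rule prod_square_diff_above) (use n a in auto)
    let ?d = "fact (a - n) * fact (n - b) * fact (n + b) :: int"
    have 3: "2 * int n * fact (a + n - 1) = (c1 n + c2 n) * ?d"
      unfolding c1_def c2_def by (rule factorials_eq_two_binomials) (use n b in auto)
    have s: "(-1) ^ (n - 1) = - ((-1) ^ n :: int)" using n b by (cases n) auto
    have "2 * int a * (int n * P n * Q n) * ?d
        = 2 * int n * (int a * fact (a - n) * P n) * (fact (n - b) * fact (n + b) * Q n)"
      by (simp only: mult_ac)
    also have "\<dots> = (-1) ^ (n - 1) * (2 * int n * fact (a + n - 1)) * F"
      unfolding 1 2 by (simp only: mult_ac)
    also have "\<dots> = - (F * ((-1) ^ n * c1 n + (-1) ^ n * c2 n)) * ?d"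
      unfolding 3 s by (simp add: algebra_simps)
    finally show ?thesis by (rule mult_right_cancel[THEN iffD1, rotated]) simp
  qed
  have S: "(\<Sum>n\<in>{b..a}. (-1) ^ n * c1 n + (-1) ^ n * c2 n) = (-1) ^ a * (1 + sgn (int a - int b))"
  proof (cases "b \<le> a")
    case False
    then show ?thesis by simp
  next
    case True
    then obtain d where d: "a = b + d" using le_Suc_ex by blast
    have "(\<Sum>n\<in>{b..a}. (-1) ^ n * c2 n) = (\<Sum>j\<le>d. (-1) ^ (b + j) * c2 (b + j))"
      by (rule sum.reindex_bij_witness[of _ "\<lambda>j. b + j" "\<lambda>n. n - b"]) (use d in auto)
    also have "\<dots> = (-1) ^ b * (\<Sum>j\<le>d. (-1) ^ j * int (d choose j) * int ((a + b - 1 + j) choose d))"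
      unfolding sum_distrib_left
      by (intro sum.cong refl) (use d b in \<open>simp add: c2_def power_add mult_ac add_ac\<close>)
    also have "\<dots> = (-1) ^ a"
      by (simp only: alternating_choose_sum d power_add)
    finally have C2: "(\<Sum>n\<in>{b..a}. (-1) ^ n * c2 n) = (-1) ^ a" .
    have C1: "(\<Sum>n\<in>{b..a}. (-1) ^ n * c1 n) = (if b < a then (-1) ^ a else 0)"
    proof (cases d)
      case 0
      then show ?thesis using d by (simp add: c1_def)
    next
      case (Suc e)
      have "(\<Sum>n\<in>{b..a}. (-1) ^ n * c1 n) = (\<Sum>n\<in>{Suc b..a}. (-1) ^ n * c1 n)"
        by (rule sum.mono_neutral_right) (auto simp: c1_def)
      also have "\<dots> = (\<Sum>j\<le>e. (-1) ^ (Suc b + j) * c1 (Suc b + j))"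
        by (rule sum.reindex_bij_witness[of _ "\<lambda>j. Suc b + j" "\<lambda>n. n - Suc b"]) (use d Suc in auto)
      also have "\<dots> = (-1) ^ Suc b * (\<Sum>j\<le>e. (-1) ^ j * int (e choose j) * int ((a + b + j) choose e))"
        unfolding sum_distrib_left
        by (intro sum.cong refl) (use d Suc in \<open>simp add: c1_def power_add mult_ac add_ac\<close>)
      also have "\<dots> = (-1) ^ a"
        unfolding alternating_choose_sum d Suc by (simp add: power_add)
      finally show ?thesis using d Suc by simp
    qed
    show ?thesis unfolding sum.distrib C1 C2 using True by (auto simp: sgn_if)
  qed
  have "2 * int a * (\<Sum>n=1..N. int n * P n * Q n) = (\<Sum>n=1..N. 2 * int a * (int n * P n * Q n))"
    by (rule sum_distrib_left)
  also have "\<dots> = (\<Sum>n\<in>{b..a}. 2 * int a * (int n * P n * Q n))"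
    by (rule sum.mono_neutral_right) (use a b zero in \<open>auto simp: mult.assoc\<close>)
  also have "\<dots> = (\<Sum>n\<in>{b..a}. - (F * ((-1) ^ n * c1 n + (-1) ^ n * c2 n)))"
    by (intro sum.cong refl summand)
  also have "\<dots> = - (F * ((-1) ^ a * (1 + sgn (int a - int b))))"
    by (simp only: sum_negf sum_distrib_left[symmetric] S)
  finally show ?thesis unfolding P_def Q_def F_def by (simp only: mult_ac)
qed

section \<open>The binomial sum behind the constant\<close>

lemma fact_odd_pochhammer: "fact (2 * u + 1) = 4 ^ u * pochhammer (3 / 2) u * (fact u :: rat)"
proof (induction u)
  case (Suc u)
  have "fact (2 * Suc u + 1) = of_nat (2 * u + 3) * of_nat (2 * u + 2) * (fact (2 * u + 1) :: rat)"
    by (simp add: algebra_simps)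
  also have "\<dots> = 4 ^ Suc u * pochhammer (3 / 2) (Suc u) * fact (Suc u)"
    unfolding Suc.IH by (simp add: pochhammer_Suc algebra_simps)
  finally show ?case .
qed simp

lemma fact_even_pochhammer: "fact (2 * v) = 4 ^ v * pochhammer (1 / 2) v * (fact v :: rat)"
  using fact_double[of v, where 'a = rat] by (simp add: power_mult)

lemma pochhammer_pos_rat: "x > 0 \<Longrightarrow> pochhammer x n \<noteq> (0 :: rat)"
  using pochhammer_pos[of x n] by auto

text \<open>
  The entries with even lower index in an odd row of Pascal's triangle are, up to a factor depending
  only on the row, products of reciprocals of a function of \<open>u\<close> and a function of \<open>v\<close>. This makes the
  next sum a convolution.
\<close>
lemma choose_odd_row:
  assumes "u + v = M"
  shows "of_nat ((2 * M + 1) choose (2 * v)) =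
    (pochhammer (3 / 2) M * fact M / (pochhammer (3 / 2) u * fact u * (pochhammer (1 / 2) v * fact v)) :: rat)"
proof -
  have "of_nat ((2 * M + 1) choose (2 * v)) = (fact (2 * M + 1) / (fact (2 * v) * fact (2 * u + 1)) :: rat)"
    using assms by (subst binomial_fact) (auto simp: algebra_simps)
  also have "\<dots> = (4 ^ M * (pochhammer (3 / 2) M * fact M) / (4 ^ M * (pochhammer (3 / 2) u * fact u * (pochhammer (1 / 2) v * fact v))) :: rat)"
    unfolding fact_odd_pochhammer fact_even_pochhammer assms[symmetric] by (simp add: power_add mult_ac)
  finally show ?thesis by simp
qed

text \<open>
  Only \<open>u = \<alpha> + s\<close>, \<open>M - u = \<beta> + t\<close> with \<open>s + t = M - \<alpha> - \<beta>\<close> contribute. Extending the rising factorials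
  of \<open>choose_odd_row\<close> to the fixed lengths \<open>M - \<beta>\<close> and \<open>M - \<alpha>\<close> leaves in the numerator a product
  of two generalized binomial coefficients with lower indices \<open>s\<close> and \<open>t\<close>, and Vandermonde's
  identity applies. The two upper indices are half integers, but their sum is an integer.
\<close>
lemma weighted_odd_row_sum:
  assumes "\<alpha> + \<beta> \<le> M"
  shows "(\<Sum>u\<le>M. of_nat (u choose \<alpha>) * of_nat ((M - u) choose \<beta>) * of_nat ((2 * M + 1) choose (2 * (M - u))))
    = (pochhammer (3 / 2) M * fact M * of_nat ((2 * M - \<alpha> - \<beta>) choose (M - \<alpha> - \<beta>)) /
        (fact \<alpha> * fact \<beta> * pochhammer (3 / 2) (M - \<beta>) * pochhammer (1 / 2) (M - \<alpha>)) :: rat)"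
    (is "(\<Sum>u\<le>M. ?t u) = _")
proof -
  obtain L where L: "M = \<alpha> + \<beta> + L" using assms le_Suc_ex by blast
  define K :: rat where "K = pochhammer (3 / 2) M * fact M /
      (fact \<alpha> * fact \<beta> * pochhammer (3 / 2) (M - \<beta>) * pochhammer (1 / 2) (M - \<alpha>))"
  let ?x = "of_nat (\<beta> + L) - 1 / 2 :: rat" and ?y = "of_nat (\<alpha> + L) + 1 / 2 :: rat"
  have "(\<Sum>u\<le>M. ?t u) = (\<Sum>u\<in>{\<alpha>..\<alpha> + L}. ?t u)"
    by (rule sum.mono_neutral_right) (use L in auto)
  also have "\<dots> = (\<Sum>s\<le>L. ?t (\<alpha> + s))"
    by (rule sum.reindex_bij_witness[of _ "\<lambda>j. \<alpha> + j" "\<lambda>n. n - \<alpha>"]) auto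
  also have "\<dots> = (\<Sum>s\<in>{0..L}. K * ((?x gchoose s) * (?y gchoose (L - s))))"
    unfolding atMost_atLeast0
  proof (intro sum.cong refl)
    fix s assume "s \<in> {0..L}"
    then obtain t where t: "L = s + t" using le_Suc_ex by auto
    define u v where "u = \<alpha> + s" and "v = \<beta> + t"
    have uv: "u + v = M" "M - u = v" using L t by (auto simp: u_def v_def)
    have gx: "?x gchoose s = pochhammer (1 / 2 + of_nat v) s / fact s"
      by (simp add: gbinomial_pochhammer' t v_def algebra_simps)
    have gy: "?y gchoose t = pochhammer (3 / 2 + of_nat u) t / fact t"
      by (simp add: gbinomial_pochhammer' t u_def algebra_simps)
    have px: "pochhammer (1 / 2) (M - \<alpha>) = (pochhammer (1 / 2) v * pochhammer (1 / 2 + of_nat v) s :: rat)"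
      using pochhammer_product[of v "M - \<alpha>" "1 / 2 :: rat"] L t by (simp add: v_def)
    have py: "pochhammer (3 / 2) (M - \<beta>) = (pochhammer (3 / 2) u * pochhammer (3 / 2 + of_nat u) t :: rat)"
      using pochhammer_product[of u "M - \<beta>" "3 / 2 :: rat"] L t by (simp add: u_def)
    have bu: "of_nat (u choose \<alpha>) = (fact u / (fact \<alpha> * fact s) :: rat)"
      by (simp add: binomial_fact u_def)
    have bv: "of_nat (v choose \<beta>) = (fact v / (fact \<beta> * fact t) :: rat)"
      by (simp add: binomial_fact v_def)
    have nz: "pochhammer (1 / 2) v \<noteq> (0::rat)" "pochhammer (1 / 2 + of_nat v) s \<noteq> (0::rat)"
      "pochhammer (3 / 2) u \<noteq> (0::rat)" "pochhammer (3 / 2 + of_nat u) t \<noteq> (0::rat)"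
      by (intro pochhammer_pos_rat; simp add: add_pos_nonneg)+
    have Ls: "L - s = t" using t by simp
    have "?t u = K * ((?x gchoose s) * (?y gchoose t))"
      unfolding K_def uv(2) gx gy px py bu bv choose_odd_row[OF uv(1)]
      using nz by (simp add: divide_simps)
    then show "?t (\<alpha> + s) = K * ((?x gchoose s) * (?y gchoose (L - s)))"
      unfolding Ls u_def .
  qed
  also have "\<dots> = K * ((?x + ?y) gchoose L)"
    by (simp only: sum_distrib_left[symmetric] gbinomial_Vandermonde)
  also have "?x + ?y = of_nat (2 * M - \<alpha> - \<beta>)"
    using L by simp
  also have "of_nat (2 * M - \<alpha> - \<beta>) gchoose L = (of_nat ((2 * M - \<alpha> - \<beta>) choose (M - \<alpha> - \<beta>)) :: rat)"
    using L by (simp add: binomial_gbinomial)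
  finally show ?thesis by (simp add: K_def)
qed

text \<open>
  If \<open>\<beta> > \<alpha> + 1\<close>, the factors with \<open>\<alpha> < j < \<beta>\<close> have product \<open>1\<close>, since \<open>j \<mapsto> \<alpha> + \<beta> - j\<close> carries the
  numerators to the denominators. So the upper bound \<open>s\<^sub>i\<close> of the product in the constant may be
  replaced by \<open>\<beta> = r - i\<close>.
\<close>
lemma prod_quotient_min:
  "(\<Prod>j<min (Suc \<alpha>) \<beta>. (x - of_nat j) / (x - of_nat (\<alpha> + \<beta>) + of_nat j)) =
   (\<Prod>j<\<beta>. (x - of_nat j) / (x - of_nat (\<alpha> + \<beta>) + of_nat j :: rat))"
  if nz: "\<And>j. x - of_nat (\<alpha> + \<beta>) + of_nat j \<noteq> 0" "\<And>j. j \<le> \<alpha> + \<beta> \<Longrightarrow> x - of_nat j \<noteq> 0"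
proof (cases "\<beta> \<le> Suc \<alpha>")
  case False
  have "(\<Prod>j\<in>{Suc \<alpha>..<\<beta>}. x - of_nat (\<alpha> + \<beta>) + of_nat j) = (\<Prod>j\<in>{Suc \<alpha>..<\<beta>}. x - of_nat j)"
    by (rule prod.reindex_bij_witness[of _ "\<lambda>j. \<alpha> + \<beta> - j" "\<lambda>j. \<alpha> + \<beta> - j"])
       (auto simp: of_nat_diff)
  then have "(\<Prod>j\<in>{Suc \<alpha>..<\<beta>}. (x - of_nat j) / (x - of_nat (\<alpha> + \<beta>) + of_nat j)) = 1"
    unfolding prod_dividef using nz(2) by simp
  moreover have "{..<\<beta>} = {..<Suc \<alpha>} \<union> {Suc \<alpha>..<\<beta>}" using False by auto
  ultimately show ?thesis using False
    by (simp add: prod.union_disjoint ivl_disj_int min_def)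
qed (simp add: min_def)

text \<open>
  With \<open>x = M + 1/2\<close> the numerators and denominators of the product in the constant are twice
  \<open>x - j\<close> and \<open>x - (\<alpha> + \<beta>) + j\<close>, so the product is a quotient of the rising factorials that
  appear in \<open>weighted_odd_row_sum\<close>.
\<close>
lemma C_const_eq_sum:
  assumes "\<alpha> + \<beta> \<le> M"
  shows "C_const (2 * M + 1) (\<alpha> + \<beta> + 1) (\<alpha> + 1) * 4 ^ M =
    (-1) ^ (\<alpha> + \<beta>) * (\<Sum>u\<le>M. of_nat (u choose \<alpha>) * of_nat ((M - u) choose \<beta>) *
        of_nat ((2 * M + 1) choose (2 * (M - u))))"
proof -
  obtain L where L: "M = \<alpha> + \<beta> + L" using assms le_Suc_ex by blast
  define x :: rat where "x = of_nat M + 1 / 2"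
  have xL: "x - of_nat (\<alpha> + \<beta>) = of_nat L + 1 / 2" by (simp add: x_def L)
  have poch1: "pochhammer (3 / 2) M = pochhammer (3 / 2) (M - \<beta>) * (\<Prod>j<\<beta>. x - of_nat j)"
  proof -
    have "pochhammer (3 / 2 :: rat) M = pochhammer (3 / 2) (M - \<beta>) * pochhammer (3 / 2 + of_nat (M - \<beta>)) \<beta>"
      using pochhammer_product[of "M - \<beta>" M "3 / 2 :: rat"] L by simp
    also have "pochhammer (3 / 2 + of_nat (M - \<beta>)) \<beta> = (\<Prod>j<\<beta>. x - of_nat j)"
      unfolding pochhammer_prod
      by (rule prod.reindex_bij_witness[of _ "\<lambda>j. \<beta> - 1 - j" "\<lambda>j. \<beta> - 1 - j"])
         (auto simp: x_def L of_nat_diff)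
    finally show ?thesis .
  qed
  have poch2: "pochhammer (1 / 2) (M - \<alpha>) = pochhammer (1 / 2) L * (\<Prod>j<\<beta>. x - of_nat (\<alpha> + \<beta>) + of_nat j)"
    using pochhammer_product[of L "M - \<alpha>" "1 / 2 :: rat"] L unfolding xL
    by (simp add: pochhammer_prod add_ac atLeast0LessThan)
  have nz: "pochhammer (1 / 2) L \<noteq> (0::rat)" "pochhammer (3 / 2) (M - \<beta>) \<noteq> (0::rat)"
    by (intro pochhammer_pos_rat; simp)+
  have nz2: "x - of_nat (\<alpha> + \<beta>) + of_nat j \<noteq> 0" for j
    unfolding xL using of_nat_0_le_iff[of "L + j", where 'a = rat] by simp
  then have nz3: "(\<Prod>j<\<beta>. x - of_nat (\<alpha> + \<beta>) + of_nat j) \<noteq> 0" by simp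
  have nz4: "x - of_nat j \<noteq> 0" if "j \<le> \<alpha> + \<beta>" for j
    using nz2[of "\<alpha> + \<beta> - j"] that by (simp add: of_nat_diff)
  have "(\<Prod>j<min (\<alpha> + 1) (\<alpha> + \<beta> + 1 - (\<alpha> + 1)). (of_nat (2 * M + 1) - 2 * of_nat j) /
          (of_nat (2 * M + 1) - 2 * of_nat (\<alpha> + \<beta> + 1) + 2 + 2 * of_nat j))
      = (\<Prod>j<min (Suc \<alpha>) \<beta>. (x - of_nat j) / (x - of_nat (\<alpha> + \<beta>) + of_nat j))"
  proof (rule prod.cong)
    fix j
    have "of_nat (2 * M + 1) - 2 * of_nat j = 2 * (x - of_nat j)"
      "of_nat (2 * M + 1) - 2 * of_nat (\<alpha> + \<beta> + 1) + 2 + 2 * of_nat j = 2 * (x - of_nat (\<alpha> + \<beta>) + of_nat j)"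
      by (simp_all add: x_def algebra_simps)
    then show "(of_nat (2 * M + 1) - 2 * of_nat j) / (of_nat (2 * M + 1) - 2 * of_nat (\<alpha> + \<beta> + 1) + 2 + 2 * of_nat j)
       = (x - of_nat j) / (x - of_nat (\<alpha> + \<beta>) + of_nat j)"
      by (simp only: mult_divide_mult_cancel_left_if) simp
  qed simp
  also have "\<dots> = (\<Prod>j<\<beta>. (x - of_nat j) / (x - of_nat (\<alpha> + \<beta>) + of_nat j))"
    by (rule prod_quotient_min[OF nz2 nz4])
  also have "\<dots> = pochhammer (3 / 2) M * pochhammer (1 / 2) L /
      (pochhammer (3 / 2) (M - \<beta>) * pochhammer (1 / 2) (M - \<alpha>))"
    unfolding prod_dividef poch1 poch2 using nz nz3 by simp
  finally have prod: "(\<Prod>j<min (\<alpha> + 1) (\<alpha> + \<beta> + 1 - (\<alpha> + 1)). (of_nat (2 * M + 1) - 2 * of_nat j) /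
          (of_nat (2 * M + 1) - 2 * of_nat (\<alpha> + \<beta> + 1) + 2 + 2 * of_nat j)) = \<dots>" .
  have b1: "of_nat ((2 * M + 1 - (\<alpha> + \<beta> + 1)) choose (\<alpha> + \<beta> + 1 - 1)) =
      (fact (2 * M - \<alpha> - \<beta>) / (fact (\<alpha> + \<beta>) * (4 ^ L * pochhammer (1 / 2) L * fact L)) :: rat)"
    unfolding fact_even_pochhammer[symmetric] using L by (simp add: binomial_fact algebra_simps)
  have b2: "of_nat ((\<alpha> + \<beta> + 1 - 1) choose (\<alpha> + 1 - 1)) = (fact (\<alpha> + \<beta>) / (fact \<alpha> * fact \<beta>) :: rat)"
    by (simp add: binomial_fact)
  have b3: "of_nat ((2 * M - \<alpha> - \<beta>) choose (M - \<alpha> - \<beta>)) = (fact (2 * M - \<alpha> - \<beta>) / (fact L * fact M) :: rat)"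
    using L by (simp add: binomial_fact algebra_simps)
  have p4: "(4 :: rat) ^ M = 4 ^ (\<alpha> + \<beta>) * 4 ^ L" by (simp add: L power_add)
  show ?thesis
    unfolding C_const_def weighted_odd_row_sum[OF assms] prod b1 b2 b3 p4
    using nz by (simp add: mult_ac)
qed

section \<open>Integer polynomials with many roots modulo a prime\<close>

text \<open>
  This is the bound on the number of roots of a polynomial over the field with \<open>p\<close> elements,
  stated for integer representatives and proved by splitting off one root at a time.
\<close>
lemma const_dvd_poly_of_many_roots:
  fixes f :: "int poly"
  assumes "prime p" "finite S" "degree f < card S"
    and "\<And>x. x \<in> S \<Longrightarrow> p dvd poly f x"
    and "\<And>x y. x \<in> S \<Longrightarrow> y \<in> S \<Longrightarrow> x \<noteq> y \<Longrightarrow> \<not> p dvd x - y"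
  shows "[:p:] dvd f"
  using assms(2-5)
proof (induction S arbitrary: f rule: finite_induct)
  case (insert a S)
  define g where "g = synthetic_div f a"
  have f: "f = [:- a, 1:] * g + [:poly f a:]"
    unfolding g_def by (rule synthetic_div_correct'[symmetric])
  have "[:p:] dvd g"
  proof (cases "degree f = 0")
    case True
    then have "g = 0" by (simp add: g_def synthetic_div_eq_0_iff)
    then show ?thesis by simp
  next
    case False
    show ?thesis
    proof (rule insert.IH)
      show "degree g < card S"
        using insert.prems(1) insert.hyps False by (simp add: g_def degree_synthetic_div)
      show "p dvd poly g x" if "x \<in> S" for x
      proof -
        have "poly f x = (x - a) * poly g x + poly f a"
          by (subst f) (simp add: algebra_simps)
        then have "p dvd (x - a) * poly g x"
          using insert.prems(2)[of x] insert.prems(2)[of a] that by (simp add: dvd_add_left_iff)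
        moreover have "\<not> p dvd x - a" using insert.prems(3)[of x a] insert.hyps that by auto
        ultimately show ?thesis using assms(1) by (simp add: prime_dvd_mult_iff)
      qed
      show "\<not> p dvd x - y" if "x \<in> S" "y \<in> S" "x \<noteq> y" for x y
        using insert.prems(3) that by simp
    qed
  qed
  moreover have "[:p:] dvd [:poly f a:]"
    using insert.prems(2)[of a] by (simp add: const_poly_dvd_const_poly_iff)
  ultimately show ?case by (subst f) (intro dvd_add dvd_mult)
qed simp

lemma dvd_coeffs_of_many_roots:
  fixes d :: "nat \<Rightarrow> int"
  assumes "prime p" "finite S" "n \<le> card S" "u < n"
    and "\<And>x. x \<in> S \<Longrightarrow> p dvd (\<Sum>u<n. d u * x ^ u)"
    and "\<And>x y. x \<in> S \<Longrightarrow> y \<in> S \<Longrightarrow> x \<noteq> y \<Longrightarrow> \<not> p dvd x - y"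
  shows "p dvd d u"
proof -
  define f where "f = (\<Sum>u<n. monom (d u) u)"
  have c: "coeff f i = (if i < n then d i else 0)" for i
    by (simp add: f_def coeff_sum)
  have "degree f \<le> n - 1" by (rule degree_le) (auto simp: c)
  then have "[:p:] dvd f"
    using assms by (intro const_dvd_poly_of_many_roots[of p S]) (auto simp: f_def poly_sum poly_monom)
  then show ?thesis using c[of u] assms(4) by (metis const_poly_dvd_iff)
qed

lemma sum_of_odd_powers:
  fixes a b :: int
  shows "(a + b) ^ (2 * M + 1) + (a - b) ^ (2 * M + 1) =
    a * (\<Sum>v\<le>M. 2 * int ((2 * M + 1) choose (2 * v)) * (a\<^sup>2) ^ (M - v) * (b\<^sup>2) ^ v)"
proof -
  let ?n = "2 * M + 1"
  have "(a + b) ^ ?n + (a - b) ^ ?n =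
      (\<Sum>j\<le>?n. int (?n choose j) * b ^ j * a ^ (?n - j) + int (?n choose j) * (- b) ^ j * a ^ (?n - j))"
    using binomial_ring[of b a ?n] binomial_ring[of "- b" a ?n] by (simp add: sum.distrib add.commute)
  also have "\<dots> = (\<Sum>v=0..M. 2 * int (?n choose (2 * v)) * b ^ (2 * v) * a ^ (?n - 2 * v))"
    using sum.in_pairs[of "\<lambda>j. int (?n choose j) * b ^ j * a ^ (?n - j) + int (?n choose j) * (- b) ^ j * a ^ (?n - j)" 0 M]
    by (simp add: atMost_atLeast0 mult_ac del: sum.cl_ivl_Suc)
  also have "\<dots> = (\<Sum>v\<le>M. a * (2 * int (?n choose (2 * v)) * (a\<^sup>2) ^ (M - v) * (b\<^sup>2) ^ v))"
  proof (intro sum.cong)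
    fix v assume "v \<in> {..M}"
    then have e: "?n - 2 * v = Suc (2 * (M - v))" by auto
    show "2 * int (?n choose (2 * v)) * b ^ (2 * v) * a ^ (?n - 2 * v)
       = a * (2 * int (?n choose (2 * v)) * (a\<^sup>2) ^ (M - v) * (b\<^sup>2) ^ v)"
      unfolding e power_Suc power_mult by (simp only: mult_ac)
  qed (simp add: atMost_atLeast0)
  finally show ?thesis by (simp only: sum_distrib_left)
qed


section \<open>Arithmetic modulo an odd prime\<close>

locale half_prime =
  fixes p N :: nat
  assumes prime: "prime p" and p: "p = 2 * N + 1"
begin

lemma N_pos: "0 < N" using prime p by (cases N) auto

lemma prime_int: "prime (int p)" using prime by simp

lemma not_dvd_small: "0 < x \<Longrightarrow> x < int p \<Longrightarrow> \<not> int p dvd x"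
  by (auto dest: zdvd_imp_le)

lemma coprime_small: "0 < x \<Longrightarrow> x < int p \<Longrightarrow> coprime x (int p)"
  using not_dvd_small prime_int by (metis coprime_commute prime_imp_coprime)

lemma coprime_two: "coprime 2 (int p)" by (rule coprime_small) (use p N_pos in auto)

lemma fermat:
  assumes "\<not> int p dvd c"
  shows "[c ^ (2 * N) = 1] (mod int p)"
proof -
  have "\<not> p dvd nat \<bar>c\<bar>" using assms by (simp add: int_dvd_int_iff[symmetric])
  then have "[nat \<bar>c\<bar> ^ (p - 1) = 1] (mod p)" by (intro fermat_theorem prime)
  then have "[int (nat \<bar>c\<bar> ^ (p - 1)) = int 1] (mod int p)" by (simp only: cong_int_iff)
  then have "[\<bar>c\<bar> ^ (2 * N) = 1] (mod int p)" using p by simp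
  then show ?thesis by (simp only: power_even_abs[of "2 * N" c] dvd_triv_left)
qed

text \<open>
  By Fermat's theorem this integer represents \<open>1/n\<close> modulo \<open>p\<close>. Using a power instead of a
  chosen inverse keeps all computations in the integers.
\<close>
definition inv_mod :: "nat \<Rightarrow> int" where "inv_mod n = int n ^ (p - 2)"

lemma inv_mod_mult:
  assumes "n \<in> {1..N}"
  shows "[int n * inv_mod n = 1] (mod int p)"
proof -
  have "int n * inv_mod n = int n ^ (2 * N)"
    unfolding inv_mod_def power_Suc[symmetric] using p N_pos by (simp add: Suc_diff_Suc numeral_2_eq_2)
  then show ?thesis using fermat[of "int n"] not_dvd_small[of "int n"] assms p by simp
qed

lemma inv_mod_square:
  assumes "n \<in> {1..N}"
  shows "[(int n)\<^sup>2 * (inv_mod n)\<^sup>2 = 1] (mod int p)"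
  using cong_pow[OF inv_mod_mult[OF assms], of 2] by (simp add: power_mult_distrib)

lemma square_diff_not_dvd:
  assumes "m \<in> {1..N}" "n \<in> {1..N}" "m \<noteq> n"
  shows "\<not> int p dvd (int m)\<^sup>2 - (int n)\<^sup>2"
proof
  assume "int p dvd (int m)\<^sup>2 - (int n)\<^sup>2"
  then have "int p dvd (int m - int n) * (int m + int n)"
    by (simp add: power2_eq_square algebra_simps)
  then have "int p dvd int m - int n \<or> int p dvd int m + int n"
    using prime_int by (simp add: prime_dvd_mult_iff)
  then show False
  proof
    assume "int p dvd int m - int n"
    then have "int p dvd \<bar>int m - int n\<bar>" by simp
    moreover have "0 < \<bar>int m - int n\<bar>" "\<bar>int m - int n\<bar> < int p"
      using assms p by (auto simp: abs_less_iff)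
    ultimately show False using not_dvd_small by blast
  next
    assume "int p dvd int m + int n"
    then show False using not_dvd_small[of "int m + int n"] assms p by auto
  qed
qed

definition squares :: "int set" where "squares = (\<lambda>a. (int a)\<^sup>2) ` {1..N}"

lemma card_squares: "finite squares" "card squares = N"
proof -
  have "inj_on (\<lambda>a. (int a)\<^sup>2) {1..N}" by (rule inj_onI) simp
  then show "card squares = N" unfolding squares_def by (simp add: card_image)
qed (simp add: squares_def)

lemma squares_distinct: "x \<in> squares \<Longrightarrow> y \<in> squares \<Longrightarrow> x \<noteq> y \<Longrightarrow> \<not> int p dvd x - y"
  unfolding squares_def using square_diff_not_dvd by fastforce

text \<open>
  This represents the product of the factors \<open>1 - X/m\<^sup>2\<close>; its coefficient at \<open>X\<^sup>u\<close> is \<open>(-1)\<^sup>u\<close> times the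
  \<open>u\<close>-th elementary symmetric function of the \<open>1/m\<^sup>2\<close>.
\<close>
definition recip_poly :: "nat set \<Rightarrow> int poly" where "recip_poly S = (\<Prod>m\<in>S. [:1, - ((inv_mod m)\<^sup>2):])"

lemma degree_recip_poly: "finite S \<Longrightarrow> degree (recip_poly S) \<le> card S"
proof -
  assume "finite S"
  then have "degree (recip_poly S) \<le> sum (degree \<circ> (\<lambda>m. [:1, - ((inv_mod m)\<^sup>2):])) S"
    unfolding recip_poly_def by (rule degree_prod_sum_le)
  also have "\<dots> \<le> (\<Sum>m\<in>S. 1)" by (intro sum_mono) simp
  finally show ?thesis by simp
qed

lemma poly_recip_poly: "poly (recip_poly S) x = (\<Prod>m\<in>S. 1 - (inv_mod m)\<^sup>2 * x)"
  by (simp add: recip_poly_def poly_prod algebra_simps)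

lemma coeff_recip_poly_0: "coeff (recip_poly S) 0 = 1"
  using poly_recip_poly[of S 0] by (simp add: poly_0_coeff_0)

text \<open>
  The product over all \<open>m \<le> N\<close> is \<open>1 - X\<^sup>N\<close> modulo \<open>p\<close>: the difference has degree at most \<open>N\<close> and
  vanishes at \<open>0\<close> and at the \<open>N\<close> nonzero squares.
\<close>
lemma coeff_recip_poly_full:
  assumes "0 < t" "t < N"
  shows "[coeff (recip_poly {1..N}) t = 0] (mod int p)"
proof -
  define f where "f = recip_poly {1..N} - (1 - monom 1 N)"
  have "[:int p:] dvd f"
  proof (rule const_dvd_poly_of_many_roots[of _ "insert 0 squares"])
    have zero_notin: "0 \<notin> squares" by (auto simp: squares_def)
    have "degree f \<le> N" unfolding f_def
      by (intro degree_diff_le) (use degree_recip_poly[of "{1..N}"] in \<open>auto simp: degree_monom_le\<close>)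
    then show "degree f < card (insert 0 squares)" using zero_notin card_squares by simp
    have root: "int p dvd poly f ((int a)\<^sup>2)" if a: "a \<in> {1..N}" for a
    proof -
      have "[1 - (inv_mod a)\<^sup>2 * (int a)\<^sup>2 = 1 - 1] (mod int p)"
        by (intro cong_diff cong_refl) (use inv_mod_square[OF a] in \<open>simp add: mult.commute\<close>)
      then have "int p dvd 1 - (inv_mod a)\<^sup>2 * (int a)\<^sup>2" by (simp add: cong_0_iff)
      also have "\<dots> dvd poly (recip_poly {1..N}) ((int a)\<^sup>2)"
        unfolding poly_recip_poly using a by (intro dvd_prodI) auto
      finally have 1: "int p dvd poly (recip_poly {1..N}) ((int a)\<^sup>2)" .
      have "[int a ^ (2 * N) = 1] (mod int p)"
        using a p by (intro fermat not_dvd_small) auto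
      then have 2: "int p dvd int a ^ (2 * N) - 1" by (simp add: cong_iff_dvd_diff)
      have "poly f ((int a)\<^sup>2) = poly (recip_poly {1..N}) ((int a)\<^sup>2) + (int a ^ (2 * N) - 1)"
        by (simp add: f_def poly_monom power_mult)
      then show ?thesis using 1 2 by simp
    qed
    show "int p dvd poly f x" if "x \<in> insert 0 squares" for x
    proof (cases "x = 0")
      case True
      then show ?thesis using N_pos by (simp add: f_def poly_monom poly_recip_poly power_0_left)
    next
      case False
      then show ?thesis using that root by (auto simp: squares_def)
    qed
    have nd: "\<not> int p dvd x" if "x \<in> squares" for x
      using that prime_int not_dvd_small p by (auto simp: squares_def prime_dvd_power_iff)
    show "\<not> int p dvd x - y" if "x \<in> insert 0 squares" "y \<in> insert 0 squares" "x \<noteq> y" for x y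
      using that squares_distinct[of x y] nd by auto
  qed (use prime_int card_squares in auto)
  then have "int p dvd coeff f t" by (simp add: const_poly_dvd_iff)
  moreover have "coeff f t = coeff (recip_poly {1..N}) t" using assms by (simp add: f_def)
  ultimately show ?thesis by (simp add: cong_0_iff)
qed


section \<open>Values of the mixed product sum\<close>

text \<open>
  Modulo \<open>p\<close> the factor \<open>N + b + 1\<close> is the negative of \<open>N - b\<close>, so moving one factor from \<open>(N - b)!\<close> to
  \<open>(N + b)!\<close> changes the sign.
\<close>
lemma fact_reflect:
  assumes "b \<le> N"
  shows "[fact (N - b) * fact (N + b) = (-1) ^ b * (fact N)\<^sup>2] (mod int p)"
  using assms
proof (induction b)
  case 0
  then show ?case by (simp add: power2_eq_square)
next
  case (Suc b)
  let ?d = "int (N - b)"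
  have d: "fact (N - b) = ?d * fact (N - Suc b)"
    using Suc.prems by (subst fact_reduce) auto
  have "?d * (fact (N - Suc b) * fact (N + Suc b)) = (int p - ?d) * (fact (N - b) * fact (N + b))"
    unfolding d using Suc.prems p by (simp add: algebra_simps)
  also have "[\<dots> = (0 - ?d) * ((-1) ^ b * (fact N)\<^sup>2)] (mod int p)"
    using Suc by (intro cong_mult[OF cong_diff[OF _ cong_refl]]) (auto simp: cong_0_iff)
  also have "(0 - ?d) * ((-1) ^ b * (fact N)\<^sup>2) = ?d * ((-1) ^ Suc b * (fact N)\<^sup>2)"
    by simp
  finally have "[?d * (fact (N - Suc b) * fact (N + Suc b)) = ?d * ((-1) ^ Suc b * (fact N)\<^sup>2)] (mod int p)" .
  moreover have "coprime ?d (int p)" using Suc.prems p by (intro coprime_small) auto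
  ultimately show ?case by (simp only: cong_mult_lcancel)
qed

lemma coprime_fact: "coprime (fact N :: int) (int p)"
proof -
  have "coprime (fact m :: int) (int p)" if "m \<le> N" for m
    using that
  proof (induction m)
    case (Suc m)
    then have "coprime (int (Suc m)) (int p)" using p by (intro coprime_small) auto
    then show ?case using Suc by (simp add: coprime_mult_left_iff del: of_nat_Suc)
  qed simp
  then show ?thesis by simp
qed

lemma clear_denominators:
  assumes "S \<subseteq> {1..N}"
  shows "[(\<Prod>m\<in>S. (int m)\<^sup>2) * poly (recip_poly S) x = (\<Prod>m\<in>S. (int m)\<^sup>2 - x)] (mod int p)"
proof -
  have "(\<Prod>m\<in>S. (int m)\<^sup>2) * poly (recip_poly S) x = (\<Prod>m\<in>S. (int m)\<^sup>2 - (int m)\<^sup>2 * (inv_mod m)\<^sup>2 * x)"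
    unfolding poly_recip_poly prod.distrib[symmetric] by (simp add: algebra_simps)
  also have "[\<dots> = (\<Prod>m\<in>S. (int m)\<^sup>2 - 1 * x)] (mod int p)"
    by (rule cong_prod, rule cong_diff[OF cong_refl], rule cong_mult[OF _ cong_refl], rule inv_mod_square)
       (use assms in auto)
  finally show ?thesis by simp
qed

lemma fact_square_split:
  assumes "n \<in> {1..N}"
  shows "(fact N)\<^sup>2 = (\<Prod>m\<in>{1..<n}. (int m)\<^sup>2) * (int n)\<^sup>2 * (\<Prod>m\<in>{n<..N}. (int m)\<^sup>2)"
proof -
  have *: "{1..N} = insert n ({1..<n} \<union> {n<..N})" using assms by auto
  have "(fact N)\<^sup>2 = (\<Prod>m\<in>{1..N}. (int m)\<^sup>2)"
    by (simp add: fact_prod prod_power_distrib)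
  also have "\<dots> = (int n)\<^sup>2 * (\<Prod>m\<in>{1..<n} \<union> {n<..N}. (int m)\<^sup>2)"
    unfolding * by (subst prod.insert) auto
  also have "\<dots> = (int n)\<^sup>2 * ((\<Prod>m\<in>{1..<n}. (int m)\<^sup>2) * (\<Prod>m\<in>{n<..N}. (int m)\<^sup>2))"
    by (subst prod.union_disjoint) auto
  finally show ?thesis by (simp only: mult_ac)
qed

text \<open>
  Multiplying by \<open>(N!)\<^sup>2\<close> clears all denominators and yields the exact sum \<open>two_parameter_sum\<close>; the
  factor \<open>(N - b)! (N + b)!\<close> in its value is \<open>(-1)\<^sup>b (N!)\<^sup>2\<close> modulo \<open>p\<close>.
\<close>
lemma mixed_product_values:
  assumes a: "a \<in> {1..N}" and b: "b \<in> {1..N}"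
  shows "[2 * (int a * (\<Sum>n=1..N. inv_mod n * poly (recip_poly {1..<n}) ((int a)\<^sup>2) * poly (recip_poly {n<..N}) ((int b)\<^sup>2)))
     = - ((-1) ^ (a + b) * (1 + sgn (int a - int b)))] (mod int p)"
proof -
  define F :: int where "F = (fact N)\<^sup>2"
  define A B where "A n = poly (recip_poly {1..<n}) ((int a)\<^sup>2)" and "B n = poly (recip_poly {n<..N}) ((int b)\<^sup>2)" for n
  define A' B' where "A' n = (\<Prod>m\<in>{1..<n}. (int m)\<^sup>2 - (int a)\<^sup>2)"
    and "B' n = (\<Prod>m\<in>{n<..N}. (int m)\<^sup>2 - (int b)\<^sup>2)" for n
  define L where "L = (\<Sum>n=1..N. inv_mod n * A n * B n)"
  define s :: int where "s = 1 + sgn (int a - int b)"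
  have summand: "[F * (inv_mod n * A n * B n) = int n * A' n * B' n] (mod int p)" if n: "n \<in> {1..N}" for n
  proof -
    define U V where "U = (\<Prod>m\<in>{1..<n}. (int m)\<^sup>2)" and "V = (\<Prod>m\<in>{n<..N}. (int m)\<^sup>2)"
    have U: "[U * A n = A' n] (mod int p)" and V: "[V * B n = B' n] (mod int p)"
      unfolding U_def V_def A_def B_def A'_def B'_def by (rule clear_denominators; use n in auto)+
    have F: "F = U * (int n)\<^sup>2 * V"
      unfolding F_def U_def V_def by (rule fact_square_split[OF n])
    have "F * (inv_mod n * A n * B n) = (int n * inv_mod n) * (int n * ((U * A n) * (V * B n)))"
      unfolding F by (simp add: power2_eq_square)
    also have "[\<dots> = 1 * (int n * (A' n * B' n))] (mod int p)"
      by (rule cong_mult[OF inv_mod_mult[OF n] cong_mult[OF cong_refl cong_mult[OF U V]]])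
    finally show ?thesis by (simp add: mult.assoc)
  qed
  have "F * L = (\<Sum>n=1..N. F * (inv_mod n * A n * B n))"
    unfolding L_def by (rule sum_distrib_left)
  also have "[\<dots> = (\<Sum>n=1..N. int n * A' n * B' n)] (mod int p)"
    by (rule cong_sum) (rule summand)
  finally have "[2 * int a * (F * L) = 2 * int a * (\<Sum>n=1..N. int n * A' n * B' n)] (mod int p)"
    by (rule cong_scalar_left)
  also have "2 * int a * (\<Sum>n=1..N. int n * A' n * B' n) = - ((-1) ^ a * s * (fact (N - b) * fact (N + b)))"
    unfolding A'_def B'_def s_def by (rule two_parameter_sum) (use a b in auto)
  also have "[\<dots> = - ((-1) ^ a * s * ((-1) ^ b * F))] (mod int p)"
    unfolding F_def cong_minus_minus_iff by (rule cong_scalar_left, rule fact_reflect) (use b in auto)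
  finally have "[F * (2 * (int a * L)) = F * (- ((-1) ^ (a + b) * s))] (mod int p)"
    by (simp add: power_add mult_ac)
  moreover have "coprime F (int p)" using coprime_fact by (simp add: F_def)
  ultimately have "[2 * (int a * L) = - ((-1) ^ (a + b) * s)] (mod int p)"
    by (simp only: cong_mult_lcancel)
  then show ?thesis unfolding L_def A_def B_def s_def .
qed


section \<open>Values of the generating polynomial of odd power sums\<close>

text \<open>
  The exponent is \<open>p - 1 - (2M + 1)\<close>, so for \<open>M < N\<close> this integer represents the sum of
  \<open>1/n\<^sup>2\<^sup>M\<^sup>+\<^sup>1\<close> over \<open>0 < n < p/2\<close>, that is, \<open>\<zeta>(2M + 1)\<close> modulo \<open>p\<close>.
\<close>
definition odd_power_sum :: "nat \<Rightarrow> int" where "odd_power_sum M = (\<Sum>n=1..N. int n ^ (2 * (N - Suc M) + 1))"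
text \<open>
  The power of \<open>2\<close> represents \<open>1 / 2\<^sup>2\<^sup>M\<^sup>+\<^sup>1\<close> modulo \<open>p\<close>, so the polynomial below is the generating
  polynomial of the values \<open>\<zeta>(2M + 1)\<close> evaluated at \<open>c/2\<close>.
\<close>
definition halved_coeff :: "nat \<Rightarrow> int" where "halved_coeff M = odd_power_sum M * 2 ^ (2 * (N - Suc M) + 1)"
definition odd_zeta_poly :: "int \<Rightarrow> int" where "odd_zeta_poly c = (\<Sum>M<N. halved_coeff M * c ^ (2 * M + 1))"

lemma odd_zeta_poly_minus: "odd_zeta_poly (- c) = - odd_zeta_poly c"
  by (simp add: odd_zeta_poly_def sum_negf)

text \<open>
  The value at \<open>c\<close> is the sum over \<open>n\<close> of the geometric progressions \<open>\<Sum> (c/2n)\<^sup>j\<close> with odd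
  \<open>j < p - 1\<close>. Such a progression has \<open>N\<close> terms and ratio \<open>(c/2n)\<^sup>2\<close>, whose \<open>N\<close>-th power is \<open>1\<close>; it
  vanishes unless the ratio is \<open>1\<close>, which happens only for \<open>n = m\<close>, where all terms are \<open>e\<close>.
\<close>
lemma odd_zeta_poly_at_even_multiple:
  assumes c: "[c = e * (2 * int m)] (mod int p)" and e: "e\<^sup>2 = 1" and m: "m \<in> {1..N}"
  shows "[odd_zeta_poly c = e * int N] (mod int p)"
proof -
  define inner where "inner n = (\<Sum>i<N. (int (2 * n))\<^sup>2 ^ (N - Suc i) * (c\<^sup>2) ^ i)" for n
  have as_sum: "odd_zeta_poly c = (\<Sum>n=1..N. c * int (2 * n) * inner n)"
  proof -
    have "odd_zeta_poly c = (\<Sum>M<N. \<Sum>n=1..N. c * int (2 * n) * ((int (2 * n))\<^sup>2 ^ (N - Suc M) * (c\<^sup>2) ^ M))"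
      unfolding odd_zeta_poly_def halved_coeff_def odd_power_sum_def sum_distrib_right
      by (intro sum.cong refl) (simp only: of_nat_mult of_nat_numeral power_add power_one_right
        power_mult_distrib power_mult mult_ac, simp add: power_mult[symmetric] mult.commute)
    also have "\<dots> = (\<Sum>n=1..N. \<Sum>M<N. c * int (2 * n) * ((int (2 * n))\<^sup>2 ^ (N - Suc M) * (c\<^sup>2) ^ M))"
      by (rule sum.swap)
    finally show ?thesis by (simp only: inner_def sum_distrib_left)
  qed
  have const: "(\<Sum>i<N. y ^ (N - Suc i) * y ^ i) = int N * y ^ (N - 1)" for y :: int
    by (simp add: power_add[symmetric])
  have c2: "[c\<^sup>2 = (int (2 * m))\<^sup>2] (mod int p)"
    using cong_pow[OF c, of 2] e by (simp add: power_mult_distrib)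
  have nd2: "\<not> int p dvd int (2 * n)" if "n \<in> {1..N}" for n
    by (rule not_dvd_small) (use that p in auto)
  have ndc: "\<not> int p dvd c"
  proof
    assume "int p dvd c"
    then have "int p dvd c\<^sup>2" by (simp add: power2_eq_square)
    then have "int p dvd (int (2 * m))\<^sup>2" using c2 by (simp add: cong_dvd_iff)
    then show False using nd2[OF m] prime_int prime_dvd_power by blast
  qed
  have zero: "[c * int (2 * n) * inner n = 0] (mod int p)" if n: "n \<in> {1..N}" "n \<noteq> m" for n
  proof -
    have "(c\<^sup>2 - (int (2 * n))\<^sup>2) * inner n = (c\<^sup>2) ^ N - ((int (2 * n))\<^sup>2) ^ N"
      unfolding inner_def by (rule power_diff_sumr2[symmetric])
    also have "\<dots> = c ^ (2 * N) - int (2 * n) ^ (2 * N)" by (simp only: power_mult)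
    also have "[\<dots> = 1 - 1] (mod int p)"
      by (intro cong_diff fermat ndc nd2 n)
    finally have "int p dvd (c\<^sup>2 - (int (2 * n))\<^sup>2) * inner n" by (simp add: cong_0_iff)
    moreover have "\<not> int p dvd c\<^sup>2 - (int (2 * n))\<^sup>2"
    proof
      assume "int p dvd c\<^sup>2 - (int (2 * n))\<^sup>2"
      then have "[c\<^sup>2 = (int (2 * n))\<^sup>2] (mod int p)" by (simp add: cong_iff_dvd_diff)
      then have "[(int (2 * m))\<^sup>2 = (int (2 * n))\<^sup>2] (mod int p)" by (rule cong_trans[OF cong_sym[OF c2]])
      then have "int p dvd 2 * (2 * ((int m)\<^sup>2 - (int n)\<^sup>2))"
        by (simp add: cong_iff_dvd_diff power_mult_distrib algebra_simps)
      then have "int p dvd (int m)\<^sup>2 - (int n)\<^sup>2"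
        using coprime_two by (simp only: coprime_dvd_mult_right_iff coprime_commute)
      then show False using square_diff_not_dvd[of m n] m n by simp
    qed
    ultimately have "int p dvd inner n" using prime_int by (simp add: prime_dvd_mult_iff)
    then show ?thesis by (simp add: cong_0_iff)
  qed
  have "[odd_zeta_poly c = (\<Sum>n=1..N. if n = m then c * int (2 * n) * inner n else 0)] (mod int p)"
    unfolding as_sum by (rule cong_sum) (use zero in auto)
  also have "(\<Sum>n=1..N. if n = m then c * int (2 * n) * inner n else 0) = c * int (2 * m) * inner m"
    using m by simp
  also have "[\<dots> = e * (2 * int m) * int (2 * m) * (\<Sum>i<N. (int (2 * m))\<^sup>2 ^ (N - Suc i) * ((int (2 * m))\<^sup>2) ^ i)] (mod int p)"
    unfolding inner_def by (intro cong_mult cong_sum cong_pow cong_refl c c2)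
  also have "(\<Sum>i<N. (int (2 * m))\<^sup>2 ^ (N - Suc i) * ((int (2 * m))\<^sup>2) ^ i) = int N * ((int (2 * m))\<^sup>2) ^ (N - 1)"
    by (rule const)
  also have "e * (2 * int m) * int (2 * m) * (int N * ((int (2 * m))\<^sup>2) ^ (N - 1)) = e * int N * ((int (2 * m))\<^sup>2 * ((int (2 * m))\<^sup>2) ^ (N - 1))"
    by (simp add: power2_eq_square)
  also have "\<dots> = e * int N * int (2 * m) ^ (2 * N)"
    unfolding power_Suc[symmetric] power_mult using N_pos by simp
  also have "[\<dots> = e * int N * 1] (mod int p)"
    by (intro cong_mult cong_refl fermat nd2 m)
  finally show ?thesis by simp
qed

text \<open>An odd \<open>c\<close> is congruent to \<open>c - p\<close>, the negative of an even number in the range \<open>2, \<dots>, 2N\<close>.\<close>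
lemma odd_zeta_poly_at_nat:
  assumes "0 < c" "c \<le> 2 * N"
  shows "[odd_zeta_poly (int c) = (-1) ^ c * int N] (mod int p)"
proof (cases "even c")
  case True
  then obtain m where "c = 2 * m" by blast
  then show ?thesis using odd_zeta_poly_at_even_multiple[of "int c" 1 m] assms by simp
next
  case False
  then obtain m where m: "c = 2 * m + 1" by (rule oddE)
  have "int c = - 1 * (2 * int (N - m)) + int p * 1" using m assms p by (simp add: of_nat_diff)
  then have "[int c = - 1 * (2 * int (N - m))] (mod int p)"
    by (metis cong_iff_lin cong_sym)
  then have "[odd_zeta_poly (int c) = - 1 * int N] (mod int p)"
    by (rule odd_zeta_poly_at_even_multiple) (use m assms in auto)
  then show ?thesis using False by simp
qed

lemma odd_zeta_poly_sum_values:
  assumes a: "a \<in> {1..N}" and b: "b \<in> {1..N}"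
  shows "[odd_zeta_poly (int a + int b) + odd_zeta_poly (int a - int b) = int N * ((-1) ^ (a + b) * (1 + sgn (int a - int b)))] (mod int p)"
proof -
  have 1: "[odd_zeta_poly (int a + int b) = (-1) ^ (a + b) * int N] (mod int p)"
    using odd_zeta_poly_at_nat[of "a + b"] a b by simp
  have 2: "[odd_zeta_poly (int a - int b) = (-1) ^ (a + b) * int N * sgn (int a - int b)] (mod int p)"
  proof (cases a b rule: linorder_cases)
    case less
    then obtain d where d: "b = a + d" "0 < d" using less_imp_add_positive by blast
    have e: "int a - int b = - int d" using d by simp
    have s: "(-1) ^ (a + b) = ((-1) ^ d :: int)" using d by (simp add: power_add)
    have "[- odd_zeta_poly (int d) = - ((-1) ^ d * int N)] (mod int p)"
      unfolding cong_minus_minus_iff using odd_zeta_poly_at_nat[of d] d b by simp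
    then show ?thesis unfolding e s odd_zeta_poly_minus using d by simp
  next
    case equal
    then show ?thesis by (simp add: odd_zeta_poly_def)
  next
    case greater
    then obtain d where d: "a = b + d" "0 < d" using less_imp_add_positive by blast
    have e: "int a - int b = int d" using d by simp
    have s: "(-1) ^ (a + b) = ((-1) ^ d :: int)" using d by (simp add: power_add)
    show ?thesis unfolding e s using odd_zeta_poly_at_nat[of d] d a by simp
  qed
  show ?thesis using cong_add[OF 1 2] by (simp add: algebra_simps)
qed


section \<open>Comparison of coefficients\<close>

text \<open>Since \<open>2N = p - 1\<close>, the factor \<open>N\<close> in the values of the polynomial represents \<open>- 1/2\<close>.\<close>
lemma mixed_product_cong_odd_zeta_poly:
  assumes a: "a \<in> {1..N}" and b: "b \<in> {1..N}"
  shows "[int a * (\<Sum>n=1..N. inv_mod n * poly (recip_poly {1..<n}) ((int a)\<^sup>2) * poly (recip_poly {n<..N}) ((int b)\<^sup>2))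
     = odd_zeta_poly (int a + int b) + odd_zeta_poly (int a - int b)] (mod int p)"
    (is "[?L = ?R] (mod _)")
proof -
  let ?X = "(-1) ^ (a + b) * (1 + sgn (int a - int b))"
  have "[2 * ?R = 2 * (int N * ?X)] (mod int p)"
    by (intro cong_mult cong_refl odd_zeta_poly_sum_values a b)
  also have "2 * (int N * ?X) = (int p - 1) * ?X" using p by simp
  also have "[\<dots> = (0 - 1) * ?X] (mod int p)"
    by (intro cong_mult cong_diff cong_refl) (simp add: cong_0_iff)
  also have "(0 - 1) * ?X = - ?X" by simp
  finally have R: "[2 * ?R = - ?X] (mod int p)" .
  have "[2 * ?L = 2 * ?R] (mod int p)"
    by (rule cong_trans[OF mixed_product_values[OF a b] cong_sym[OF R]])
  then show ?thesis using coprime_two by (simp only: cong_mult_lcancel)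
qed

text \<open>This represents \<open>(-1)\<^sup>u\<^sup>+\<^sup>v \<zeta>({2}\<^sup>u, 1, {2}\<^sup>v)\<close> modulo \<open>p\<close>.\<close>
definition mixed_sum :: "nat \<Rightarrow> nat \<Rightarrow> int" where
  "mixed_sum u v = (\<Sum>n=1..N. inv_mod n * coeff (recip_poly {1..<n}) u * coeff (recip_poly {n<..N}) v)"

lemma poly_recip_poly_eq_sum:
  assumes "finite S" "card S < N"
  shows "poly (recip_poly S) x = (\<Sum>u<N. coeff (recip_poly S) u * x ^ u)"
proof -
  have "poly (recip_poly S) x = (\<Sum>u\<le>degree (recip_poly S). coeff (recip_poly S) u * x ^ u)" by (rule poly_altdef)
  also have "\<dots> = (\<Sum>u<N. coeff (recip_poly S) u * x ^ u)"
    by (rule sum.mono_neutral_left) (use degree_recip_poly[of S] assms in \<open>auto simp: coeff_eq_0\<close>)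
  finally show ?thesis .
qed

lemma mixed_product_expand:
  "(\<Sum>n=1..N. inv_mod n * poly (recip_poly {1..<n}) x * poly (recip_poly {n<..N}) y) = (\<Sum>u<N. (\<Sum>v<N. mixed_sum u v * y ^ v) * x ^ u)"
proof -
  have "(\<Sum>n=1..N. inv_mod n * poly (recip_poly {1..<n}) x * poly (recip_poly {n<..N}) y) =
     (\<Sum>n=1..N. \<Sum>u<N. \<Sum>v<N. inv_mod n * coeff (recip_poly {1..<n}) u * coeff (recip_poly {n<..N}) v * y ^ v * x ^ u)"
  proof (intro sum.cong refl)
    fix n assume n: "n \<in> {1..N}"
    then have "card {1..<n} < N" "card {n<..N} < N" by auto
    then show "inv_mod n * poly (recip_poly {1..<n}) x * poly (recip_poly {n<..N}) y =
       (\<Sum>u<N. \<Sum>v<N. inv_mod n * coeff (recip_poly {1..<n}) u * coeff (recip_poly {n<..N}) v * y ^ v * x ^ u)"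
      by (simp add: poly_recip_poly_eq_sum sum_product sum_distrib_left mult_ac)
  qed
  also have "\<dots> = (\<Sum>u<N. \<Sum>v<N. \<Sum>n=1..N. inv_mod n * coeff (recip_poly {1..<n}) u * coeff (recip_poly {n<..N}) v * y ^ v * x ^ u)"
    by (rule trans[OF sum.swap], rule sum.cong[OF refl], rule sum.swap)
  finally show ?thesis by (simp add: mixed_sum_def sum_distrib_right)
qed

text \<open>
  The coefficients are arranged by the exponents of \<open>a\<^sup>2\<close> and \<open>b\<^sup>2\<close>, padded by zeros outside the
  triangle \<open>u + v < N\<close>, so that they can be compared with those of \<open>mixed_product_expand\<close>.
\<close>
lemma odd_zeta_poly_sum_expand:
  "odd_zeta_poly (a + b) + odd_zeta_poly (a - b) = a * (\<Sum>u<N. (\<Sum>v<N.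
     (if u + v < N then 2 * halved_coeff (u + v) * int ((2 * (u + v) + 1) choose (2 * v)) else 0) * (b\<^sup>2) ^ v) * (a\<^sup>2) ^ u)"
proof -
  let ?c = "\<lambda>v u. 2 * halved_coeff (u + v) * int ((2 * (u + v) + 1) choose (2 * v)) * (b\<^sup>2) ^ v * (a\<^sup>2) ^ u"
  have "odd_zeta_poly (a + b) + odd_zeta_poly (a - b) = a * (\<Sum>M<N. \<Sum>v\<le>M. ?c v (M - v))"
    unfolding odd_zeta_poly_def sum.distrib[symmetric] distrib_left[symmetric] sum_of_odd_powers sum_distrib_left
    by (intro sum.cong refl) simp
  also have "(\<Sum>M<N. \<Sum>v\<le>M. ?c v (M - v)) = (\<Sum>(v, u)\<in>{(v, u). v + u < N}. ?c v u)"
    by (rule sum.triangle_reindex[symmetric])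
  also have "\<dots> = (\<Sum>(v, u)\<in>{..<N} \<times> {..<N}. if u + v < N then ?c v u else 0)"
    by (rule sum.mono_neutral_cong_left) (auto simp: add.commute split: if_splits)
  also have "\<dots> = (\<Sum>u<N. \<Sum>v<N. if u + v < N then ?c v u else 0)"
    by (subst sum.cartesian_product[symmetric]) (rule sum.swap)
  also have "\<dots> = (\<Sum>u<N. (\<Sum>v<N.
     (if u + v < N then 2 * halved_coeff (u + v) * int ((2 * (u + v) + 1) choose (2 * v)) else 0) * (b\<^sup>2) ^ v) * (a\<^sup>2) ^ u)"
    unfolding sum_distrib_right by (intro sum.cong refl) simp
  finally show ?thesis .
qed

text \<open>
  Two polynomials of degree less than \<open>N\<close> in each of \<open>x = a\<^sup>2\<close> and \<open>y = b\<^sup>2\<close> that agree modulo \<open>p\<close>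
  at all pairs of nonzero squares have congruent coefficients; the bound on the number of roots is applied
  first in \<open>x\<close> and then in \<open>y\<close>.
\<close>
lemma mixed_sum_cong:
  assumes uv: "u + v < N"
  shows "[4 ^ (u + v) * mixed_sum u v = int ((2 * (u + v) + 1) choose (2 * v)) * odd_power_sum (u + v)] (mod int p)"
proof -
  define r where "r u v = (if u + v < N then 2 * halved_coeff (u + v) * int ((2 * (u + v) + 1) choose (2 * v)) else 0)" for u v
  define d where "d u v = mixed_sum u v - r u v" for u v
  have vanish: "int p dvd (\<Sum>u<N. (\<Sum>v<N. d u v * y ^ v) * x ^ u)" if xy: "x \<in> squares" "y \<in> squares" for x y
  proof -
    obtain a b where ab: "a \<in> {1..N}" "b \<in> {1..N}" "x = (int a)\<^sup>2" "y = (int b)\<^sup>2"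
      using xy by (auto simp: squares_def)
    have "[int a * (\<Sum>u<N. (\<Sum>v<N. mixed_sum u v * y ^ v) * x ^ u) = int a * (\<Sum>u<N. (\<Sum>v<N. r u v * y ^ v) * x ^ u)] (mod int p)"
      using mixed_product_cong_odd_zeta_poly[OF ab(1,2)] unfolding mixed_product_expand odd_zeta_poly_sum_expand ab(3,4) r_def .
    moreover have "coprime (int a) (int p)" using ab p by (intro coprime_small) auto
    ultimately have "[(\<Sum>u<N. (\<Sum>v<N. mixed_sum u v * y ^ v) * x ^ u) = (\<Sum>u<N. (\<Sum>v<N. r u v * y ^ v) * x ^ u)] (mod int p)"
      by (simp only: cong_mult_lcancel)
    then show ?thesis
      unfolding d_def cong_iff_dvd_diff by (simp add: sum_subtractf left_diff_distrib)
  qed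
  have "int p dvd (\<Sum>v<N. d u v * y ^ v)" if "y \<in> squares" for y
    using dvd_coeffs_of_many_roots[OF prime_int card_squares(1), of N u "\<lambda>u. \<Sum>v<N. d u v * y ^ v"]
      vanish that uv card_squares squares_distinct by auto
  then have "int p dvd d u v"
    using dvd_coeffs_of_many_roots[OF prime_int card_squares(1), of N v "d u"]
      uv card_squares squares_distinct by auto
  then have "[mixed_sum u v = 2 * halved_coeff (u + v) * int ((2 * (u + v) + 1) choose (2 * v))] (mod int p)"
    using uv by (simp add: d_def r_def cong_iff_dvd_diff)
  then have "[4 ^ (u + v) * mixed_sum u v = 4 ^ (u + v) * (2 * halved_coeff (u + v) * int ((2 * (u + v) + 1) choose (2 * v)))] (mod int p)"
    by (rule cong_scalar_left)
  also have "4 ^ (u + v) * (2 * halved_coeff (u + v) * int ((2 * (u + v) + 1) choose (2 * v)))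
     = int ((2 * (u + v) + 1) choose (2 * v)) * odd_power_sum (u + v) * 2 ^ (2 * N)"
  proof -
    have "(2::int) ^ (2 * N) = 2 ^ (2 * (u + v)) * 2 * 2 ^ (2 * (N - Suc (u + v)) + 1)"
      unfolding power_Suc2[symmetric] power_add[symmetric] using uv by (intro arg_cong2[of _ _ _ _ power]) auto
    moreover have "(4::int) ^ (u + v) = 2 ^ (2 * (u + v))" by (simp only: power_mult) simp
    ultimately show ?thesis unfolding halved_coeff_def by (simp only: mult_ac)
  qed
  also have "[\<dots> = int ((2 * (u + v) + 1) choose (2 * v)) * odd_power_sum (u + v) * 1] (mod int p)"
    by (intro cong_mult cong_refl fermat not_dvd_small) (use p N_pos in auto)
  finally show ?thesis by simp
qed

end

section \<open>Generating series of even and odd powers\<close>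

definition elem_sym :: "(nat \<Rightarrow> 'a::comm_ring_1) \<Rightarrow> nat \<Rightarrow> nat set \<Rightarrow> 'a" where
  "elem_sym f r S = (\<Sum>J | J \<subseteq> S \<and> card J = r. \<Prod>m\<in>J. f m)"

lemma elem_sym_0: "finite S \<Longrightarrow> elem_sym f 0 S = 1"
proof -
  assume "finite S"
  then have "{J. J \<subseteq> S \<and> card J = 0} = {{}}" by (auto dest: finite_subset)
  then show ?thesis by (simp add: elem_sym_def)
qed

lemma elem_sym_empty: "elem_sym f (Suc r) {} = 0"
proof -
  have "{J. J \<subseteq> {} \<and> card J = Suc r} = {}" by auto
  then show ?thesis unfolding elem_sym_def by (metis sum.empty)
qed

lemma elem_sym_insert:
  assumes S: "finite S" "m \<notin> S"
  shows "elem_sym f (Suc r) (insert m S) = elem_sym f (Suc r) S + f m * elem_sym f r S"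
proof -
  let ?A = "{J. J \<subseteq> S \<and> card J = Suc r}" and ?B = "{J. J \<subseteq> S \<and> card J = r}"
  have fin: "finite ?A" "finite ?B" using S by auto
  have mem: "m \<notin> J" "finite J" if "J \<subseteq> S" for J using that S finite_subset by auto
  have "{J. J \<subseteq> insert m S \<and> card J = Suc r} = ?A \<union> insert m ` ?B"
  proof (intro equalityI subsetI)
    fix J assume J: "J \<in> {J. J \<subseteq> insert m S \<and> card J = Suc r}"
    show "J \<in> ?A \<union> insert m ` ?B"
    proof (cases "m \<in> J")
      case True
      then have "J = insert m (J - {m})" "J - {m} \<subseteq> S" "card (J - {m}) = r" using J by auto
      then show ?thesis by blast
    next
      case False
      then show ?thesis using J by auto
    qed
  next
    fix J assume "J \<in> ?A \<union> insert m ` ?B"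
    then show "J \<in> {J. J \<subseteq> insert m S \<and> card J = Suc r}" using mem by auto
  qed
  then have "elem_sym f (Suc r) (insert m S) = elem_sym f (Suc r) S + (\<Sum>J\<in>insert m ` ?B. \<Prod>m\<in>J. f m)"
    unfolding elem_sym_def using fin mem by (simp add: sum.union_disjoint disjoint_iff) (subst sum.union_disjoint, auto)
  also have "(\<Sum>J\<in>insert m ` ?B. \<Prod>m\<in>J. f m) = (\<Sum>J\<in>?B. \<Prod>m\<in>insert m J. f m)"
    by (rule sum.reindex_cong[where l = "insert m"]) (auto intro!: inj_onI dest: mem(1))
  also have "\<dots> = f m * elem_sym f r S"
    unfolding elem_sym_def sum_distrib_left by (intro sum.cong refl prod.insert) (auto dest: mem)
  finally show ?thesis .
qed

text \<open>
  With \<open>x = 1/m\<close> these are the generating series of the powers \<open>1/m\<^sup>j\<close> over even \<open>j > 0\<close> and over odd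
  \<open>j\<close>, where \<open>X\<^sup>l\<close> marks \<open>j = 2l\<close> and \<open>j = 2l + 1\<close> respectively.
\<close>
definition even_series :: "'a::comm_ring_1 \<Rightarrow> 'a fps" where
  "even_series x = Abs_fps (\<lambda>l. if l = 0 then 0 else x ^ (2 * l))"

definition odd_series :: "'a::comm_ring_1 \<Rightarrow> 'a fps" where
  "odd_series x = Abs_fps (\<lambda>l. x ^ (2 * l + 1))"

lemma fps_of_poly_one_minus:
  fixes c :: "'a::comm_ring_1"
  shows "fps_of_poly [:1, - c:] = 1 - fps_const c * fps_X"
  by (rule fps_ext) (simp add: coeff_pCons split: nat.split)

lemma even_series_mult: "fps_of_poly [:1, - (x\<^sup>2):] * even_series x = fps_const (x\<^sup>2) * fps_X"
  unfolding fps_of_poly_one_minus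
proof (rule fps_ext)
  fix n show "((1 - fps_const (x\<^sup>2) * fps_X) * even_series x) $ n = (fps_const (x\<^sup>2) * fps_X) $ n"
    by (cases n; cases "n - 1") (auto simp: even_series_def left_diff_distrib mult.assoc power2_eq_square)
qed

lemma odd_series_mult: "fps_of_poly [:1, - (x\<^sup>2):] * odd_series x = fps_const x"
  unfolding fps_of_poly_one_minus
proof (rule fps_ext)
  fix n show "((1 - fps_const (x\<^sup>2) * fps_X) * odd_series x) $ n = fps_const x $ n"
    by (cases n) (auto simp: odd_series_def left_diff_distrib mult.assoc power2_eq_square)
qed

text \<open>
  With a formal variable \<open>y\<close>, the product of \<open>1 + y (X/m\<^sup>2) / (1 - X/m\<^sup>2)\<close> has, after clearing
  denominators, the factors \<open>1 - (1 - y) X/m\<^sup>2\<close>. Hence a coefficient \<open>c\<^sub>u\<close> of the product of the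
  \<open>1 - X/m\<^sup>2\<close> is multiplied by \<open>(1 - y)\<^sup>u\<close>, and the claim is the comparison of the coefficients of \<open>y\<^sup>r\<close>.
  The induction performs this comparison without introducing \<open>y\<close>.
\<close>
lemma elem_sym_even_series:
  fixes w :: "nat \<Rightarrow> 'a :: comm_ring_1"
  assumes "finite S"
  shows "elem_sym (\<lambda>m. even_series (w m)) r S * fps_of_poly (\<Prod>m\<in>S. [:1, - ((w m)\<^sup>2):]) =
    Abs_fps (\<lambda>u. (-1) ^ r * of_nat (u choose r) * coeff (\<Prod>m\<in>S. [:1, - ((w m)\<^sup>2):]) u)"
  using assms
proof (induction S arbitrary: r rule: finite_induct)
  case empty
  show ?case
  proof (cases r)
    case 0
    then show ?thesis by (simp add: elem_sym_0) (rule fps_ext, simp)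
  next
    case (Suc r')
    then show ?thesis by (simp add: elem_sym_empty) (rule fps_ext, simp)
  qed
next
  case (insert m S)
  show ?case
  proof (cases r)
    case 0
    then show ?thesis using insert.hyps by (simp add: elem_sym_0) (rule fps_ext, simp)
  next
    case (Suc s)
    let ?f = "\<lambda>m. even_series (w m)" and ?Q = "\<Prod>m\<in>S. [:1, - ((w m)\<^sup>2):]" and ?l = "[:1, - ((w m)\<^sup>2):]"
    have Q: "(\<Prod>m\<in>insert m S. [:1, - ((w m)\<^sup>2):]) = ?l * ?Q" using insert.hyps by simp
    have "elem_sym ?f r (insert m S) * fps_of_poly (?l * ?Q)
        = fps_of_poly ?l * (elem_sym ?f (Suc s) S * fps_of_poly ?Q)
          + (fps_of_poly ?l * ?f m) * (elem_sym ?f s S * fps_of_poly ?Q)"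
      unfolding Suc elem_sym_insert[OF insert.hyps] fps_of_poly_mult by (simp only: distrib_left distrib_right mult_ac)
    also have "\<dots> = (1 - fps_const ((w m)\<^sup>2) * fps_X) * Abs_fps (\<lambda>u. (-1) ^ Suc s * of_nat (u choose Suc s) * coeff ?Q u)
        + fps_const ((w m)\<^sup>2) * fps_X * Abs_fps (\<lambda>u. (-1) ^ s * of_nat (u choose s) * coeff ?Q u)"
      unfolding insert.IH even_series_mult unfolding fps_of_poly_one_minus ..
    also have "\<dots> = Abs_fps (\<lambda>u. (-1) ^ Suc s * of_nat (u choose Suc s) * coeff (?l * ?Q) u)"
    proof (rule fps_ext)
      fix u
      show "((1 - fps_const ((w m)\<^sup>2) * fps_X) * Abs_fps (\<lambda>u. (-1) ^ Suc s * of_nat (u choose Suc s) * coeff ?Q u)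
        + fps_const ((w m)\<^sup>2) * fps_X * Abs_fps (\<lambda>u. (-1) ^ s * of_nat (u choose s) * coeff ?Q u)) $ u
        = Abs_fps (\<lambda>u. (-1) ^ Suc s * of_nat (u choose Suc s) * coeff (?l * ?Q) u) $ u"
        by (cases u) (simp_all add: left_diff_distrib mult.assoc algebra_simps)
    qed
    finally show ?thesis unfolding Q Suc .
  qed
qed

lemma prod_lessThan_add:
  fixes g :: "nat \<Rightarrow> 'a::comm_monoid_mult"
  shows "(\<Prod>j<a + b. g j) = (\<Prod>j<a. g j) * (\<Prod>j<b. g (a + j))"
  by (induction b) (simp_all add: mult_ac)

lemma prod_nth_distinct:
  "distinct xs \<Longrightarrow> (\<Prod>j<length xs. f (xs ! j)) = (\<Prod>m\<in>set xs. f m)"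
  by (simp add: prod.distinct_set_conv_list prod.list_conv_set_nth atLeast0LessThan)

text \<open>
  A chain is determined by its entry \<open>n\<close> at position \<open>\<alpha>\<close> (counted from \<open>0\<close>), the set of the \<open>\<alpha>\<close>
  entries below \<open>n\<close>, and the set of the \<open>\<beta>\<close> entries above \<open>n\<close>.
\<close>
lemma sum_half_chains:
  fixes f g :: "nat \<Rightarrow> 'a::comm_ring_1"
  assumes p: "p = 2 * N + 1"
  shows "(\<Sum>ns\<in>half_chains p (\<alpha> + Suc \<beta>). \<Prod>j<\<alpha> + Suc \<beta>. (if j = \<alpha> then g else f) (ns ! j))
    = (\<Sum>n=1..N. elem_sym f \<alpha> {1..<n} * g n * elem_sym f \<beta> {n<..N})"
proof -
  define T where "T = (SIGMA n:{1..N}. {J. J \<subseteq> {1..<n} \<and> card J = \<alpha>} \<times> {K. K \<subseteq> {n<..N} \<and> card K = \<beta>})"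
  define F where "F = (\<lambda>(n, J, K). (\<Prod>m\<in>J. f m) * g n * (\<Prod>m\<in>K. f m))"
  let ?l = sorted_list_of_set
  have chain: "\<exists>n J K. ns = ?l J @ n # ?l K \<and> (n, J, K) \<in> T \<and>
      ns ! \<alpha> = n \<and> set (take \<alpha> ns) = J \<and> set (drop (Suc \<alpha>) ns) = K" if ns: "ns \<in> half_chains p (\<alpha> + Suc \<beta>)" for ns
  proof -
    define xs n ys where "xs = take \<alpha> ns" and "n = ns ! \<alpha>" and "ys = drop (Suc \<alpha>) ns"
    have len: "length ns = \<alpha> + Suc \<beta>" using ns by (simp add: half_chains_def)
    have eq: "ns = xs @ n # ys" unfolding xs_def n_def ys_def using len by (simp add: id_take_nth_drop)
    have sw: "sorted_wrt (<) (xs @ n # ys)" and "\<forall>m\<in>set (xs @ n # ys). 0 < m \<and> 2 * m < p"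
      using ns unfolding eq half_chains_def by blast+
    then have rng: "\<forall>m\<in>set (xs @ n # ys). 1 \<le> m \<and> m \<le> N"
      using p by fastforce
    have l: "?l (set xs) = xs" "?l (set ys) = ys"
      using sw by (auto simp: sorted_wrt_append strict_sorted_iff intro: sorted_list_of_set.idem_if_sorted_distinct)
    have c: "card (set xs) = \<alpha>" "card (set ys) = \<beta>"
      using sw len by (auto simp: sorted_wrt_append strict_sorted_iff distinct_card xs_def ys_def)
    have "(n, set xs, set ys) \<in> T"
      using sw rng c by (auto simp: T_def sorted_wrt_append)
    then show ?thesis using eq l xs_def n_def ys_def by metis
  qed
  have list_of: "?l J @ n # ?l K \<in> half_chains p (\<alpha> + Suc \<beta>)"
    "(?l J @ n # ?l K) ! \<alpha> = n" "set (take \<alpha> (?l J @ n # ?l K)) = J" "set (drop (Suc \<alpha>) (?l J @ n # ?l K)) = K"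
    "(\<Prod>j<\<alpha> + Suc \<beta>. (if j = \<alpha> then g else f) ((?l J @ n # ?l K) ! j)) = F (n, J, K)"
    if t: "(n, J, K) \<in> T" for n J K
  proof -
    have J: "J \<subseteq> {1..<n}" "card J = \<alpha>" and K: "K \<subseteq> {n<..N}" "card K = \<beta>" and n: "1 \<le> n" "n \<le> N"
      using t by (auto simp: T_def)
    have fin: "finite J" "finite K" using J K finite_subset by auto
    have len: "length (?l J) = \<alpha>" "length (?l K) = \<beta>" using J K by simp_all
    have sw: "sorted_wrt (<) (?l J)" "sorted_wrt (<) (?l K)" by simp_all
    show "?l J @ n # ?l K \<in> half_chains p (\<alpha> + Suc \<beta>)"
      using J K n p fin len sw unfolding half_chains_def by (fastforce simp: sorted_wrt_append)
    show "(?l J @ n # ?l K) ! \<alpha> = n" "set (take \<alpha> (?l J @ n # ?l K)) = J" "set (drop (Suc \<alpha>) (?l J @ n # ?l K)) = K"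
      using len fin by (simp_all add: nth_append)
    have "(\<Prod>j<\<alpha> + Suc \<beta>. (if j = \<alpha> then g else f) ((?l J @ n # ?l K) ! j))
       = (\<Prod>j<\<alpha>. f (?l J ! j)) * (g n * (\<Prod>j<\<beta>. f (?l K ! j)))"
      unfolding prod_lessThan_add[of _ \<alpha>] prod.lessThan_Suc_shift using len by (simp add: nth_append)
    also have "\<dots> = F (n, J, K)"
      using prod_nth_distinct[of "?l J" f] prod_nth_distinct[of "?l K" f] fin len by (simp add: F_def mult_ac)
    finally show "(\<Prod>j<\<alpha> + Suc \<beta>. (if j = \<alpha> then g else f) ((?l J @ n # ?l K) ! j)) = F (n, J, K)" .
  qed
  have "(\<Sum>ns\<in>half_chains p (\<alpha> + Suc \<beta>). \<Prod>j<\<alpha> + Suc \<beta>. (if j = \<alpha> then g else f) (ns ! j)) = sum F T"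
  proof (rule sum.reindex_bij_witness[where i = "\<lambda>(n, J, K). ?l J @ n # ?l K"
        and j = "\<lambda>ns. (ns ! \<alpha>, set (take \<alpha> ns), set (drop (Suc \<alpha>) ns))"])
    fix ns assume "ns \<in> half_chains p (\<alpha> + Suc \<beta>)"
    from chain[OF this] obtain n J K where *: "ns = ?l J @ n # ?l K" "(n, J, K) \<in> T"
      "ns ! \<alpha> = n" "set (take \<alpha> ns) = J" "set (drop (Suc \<alpha>) ns) = K" by blast
    then show "(case (ns ! \<alpha>, set (take \<alpha> ns), set (drop (Suc \<alpha>) ns)) of (n, J, K) \<Rightarrow> ?l J @ n # ?l K) = ns"
      "(ns ! \<alpha>, set (take \<alpha> ns), set (drop (Suc \<alpha>) ns)) \<in> T" by simp_all
    show "F (ns ! \<alpha>, set (take \<alpha> ns), set (drop (Suc \<alpha>) ns)) = (\<Prod>j<\<alpha> + Suc \<beta>. (if j = \<alpha> then g else f) (ns ! j))"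
      using list_of(5)[OF *(2)] * by metis
  next
    fix t assume "t \<in> T"
    then show "(case t of (n, J, K) \<Rightarrow> ?l J @ n # ?l K) \<in> half_chains p (\<alpha> + Suc \<beta>)"
      "((case t of (n, J, K) \<Rightarrow> ?l J @ n # ?l K) ! \<alpha>, set (take \<alpha> (case t of (n, J, K) \<Rightarrow> ?l J @ n # ?l K)),
        set (drop (Suc \<alpha>) (case t of (n, J, K) \<Rightarrow> ?l J @ n # ?l K))) = t"
      using list_of by (cases t; simp)+
  qed
  also have "\<dots> = (\<Sum>n=1..N. \<Sum>(J, K)\<in>{J. J \<subseteq> {1..<n} \<and> card J = \<alpha>} \<times> {K. K \<subseteq> {n<..N} \<and> card K = \<beta>}. F (n, J, K))"
    unfolding T_def by (subst sum.Sigma) (auto simp: case_prod_unfold)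
  also have "\<dots> = (\<Sum>n=1..N. elem_sym f \<alpha> {1..<n} * g n * elem_sym f \<beta> {n<..N})"
    unfolding elem_sym_def F_def
    by (intro sum.cong refl) (simp add: sum.cartesian_product[symmetric] sum_product sum_distrib_left sum_distrib_right mult_ac)
  finally show ?thesis .
qed

lemma one_odd_indices_iff:
  assumes "\<alpha> < r"
  shows "ks \<in> one_odd_indices k r (Suc \<alpha>) \<longleftrightarrow>
    length ks = r \<and> (\<forall>j<r. 0 < ks ! j) \<and> (\<Sum>j<r. ks ! j) = k \<and> odd (ks ! \<alpha>) \<and> (\<forall>j<r. j \<noteq> \<alpha> \<longrightarrow> even (ks ! j))"
proof -
  have "(\<forall>j\<in>{1..r}. j \<noteq> Suc \<alpha> \<longrightarrow> even (ks ! (j - 1))) \<longleftrightarrow> (\<forall>j<r. j \<noteq> \<alpha> \<longrightarrow> even (ks ! j))"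
  proof safe
    fix j assume "\<forall>j\<in>{1..r}. j \<noteq> Suc \<alpha> \<longrightarrow> even (ks ! (j - 1))" "j < r" "j \<noteq> \<alpha>"
    then show "even (ks ! j)" by (auto dest: bspec[of _ _ "Suc j"])
  next
    fix j assume *: "\<forall>j<r. j \<noteq> \<alpha> \<longrightarrow> even (ks ! j)" "j \<in> {1..r}" "j \<noteq> Suc \<alpha>"
    then show "even (ks ! (j - 1))" by (cases j) auto
  qed
  then show ?thesis
    by (auto simp: one_odd_indices_def sum_list_sum_nth atLeast0LessThan all_set_conv_all_nth)
qed

text \<open>
  Halving all entries, rounded down, is a bijection from the indices to the weak compositions of \<open>M\<close> whose
  entries away from position \<open>\<alpha>\<close> are positive; these are the exponent vectors that contribute to
  the coefficient of \<open>X\<^sup>M\<close> in the product of the series.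
\<close>
lemma sum_one_odd_indices:
  fixes x :: "nat \<Rightarrow> 'a::comm_ring_1"
  assumes \<alpha>: "\<alpha> < r"
  shows "(\<Sum>ks\<in>one_odd_indices (2 * M + 1) r (Suc \<alpha>). \<Prod>j<r. x j ^ (ks ! j))
    = (\<Prod>j<r. (if j = \<alpha> then odd_series else even_series) (x j)) $ M"
proof -
  let ?G = "\<lambda>j. (if j = \<alpha> then odd_series else even_series) (x j)"
  define L where "L = {ls. length ls = r \<and> (\<Sum>j<r. ls ! j) = M \<and> (\<forall>j<r. j \<noteq> \<alpha> \<longrightarrow> 0 < ls ! j)}"
  have np: "natpermute M r = {ls. length ls = r \<and> (\<Sum>j<r. ls ! j) = M}"
    by (auto simp: natpermute_def sum_list_sum_nth atLeast0LessThan)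
  obtain m where m: "r = Suc m" using \<alpha> by (cases r) auto
  have "(\<Prod>j<r. ?G j) $ M = (\<Sum>ls\<in>natpermute M r. \<Prod>j<r. ?G j $ (ls ! j))"
    using fps_prod_nth[of ?G m M] by (simp add: m lessThan_Suc_atMost atLeast0AtMost)
  also have "\<dots> = (\<Sum>ls\<in>L. \<Prod>j<r. ?G j $ (ls ! j))"
  proof (rule sum.mono_neutral_right)
    show "finite (natpermute M r)" by (rule natpermute_finite)
    show "L \<subseteq> natpermute M r" by (auto simp: np L_def)
    show "\<forall>ls\<in>natpermute M r - L. (\<Prod>j<r. ?G j $ (ls ! j)) = 0"
    proof
      fix ls assume "ls \<in> natpermute M r - L"
      then obtain j where "j < r" "j \<noteq> \<alpha>" "ls ! j = 0" by (auto simp: np L_def)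
      then show "(\<Prod>j<r. ?G j $ (ls ! j)) = 0"
        by (intro prod_zero) (auto simp: even_series_def intro!: bexI[of _ j])
    qed
  qed
  also have "\<dots> = (\<Sum>ks\<in>one_odd_indices (2 * M + 1) r (Suc \<alpha>). \<Prod>j<r. x j ^ (ks ! j))"
  proof (rule sum.reindex_bij_witness[where i = "map (\<lambda>k. k div 2)"
        and j = "\<lambda>ls. map (\<lambda>j. 2 * ls ! j + of_bool (j = \<alpha>)) [0..<r]"])
    fix ls assume "ls \<in> L"
    then have ls: "length ls = r" "(\<Sum>j<r. ls ! j) = M" "\<And>j. j < r \<Longrightarrow> j \<noteq> \<alpha> \<Longrightarrow> 0 < ls ! j"
      by (auto simp: L_def)
    let ?ks = "map (\<lambda>j. 2 * ls ! j + of_bool (j = \<alpha>)) [0..<r]"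
    show "map (\<lambda>k. k div 2) ?ks = ls"
      by (rule nth_equalityI) (auto simp: ls)
    have "(\<Sum>j<r. ?ks ! j) = (\<Sum>j<r. 2 * ls ! j + of_bool (j = \<alpha>))" by simp
    also have "\<dots> = 2 * M + 1"
      using \<alpha> by (simp add: sum.distrib sum_distrib_left[symmetric] ls of_bool_def)
    finally show "?ks \<in> one_odd_indices (2 * M + 1) r (Suc \<alpha>)"
      unfolding one_odd_indices_iff[OF \<alpha>] using \<alpha> ls by auto
    show "(\<Prod>j<r. x j ^ (?ks ! j)) = (\<Prod>j<r. ?G j $ (ls ! j))"
    proof (intro prod.cong refl)
      fix j assume "j \<in> {..<r}"
      then show "x j ^ (?ks ! j) = ?G j $ (ls ! j)"
        using ls(3)[of j] by (cases "j = \<alpha>") (simp_all add: odd_series_def even_series_def)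
    qed
  next
    fix ks assume "ks \<in> one_odd_indices (2 * M + 1) r (Suc \<alpha>)"
    then have ks: "length ks = r" "\<And>j. j < r \<Longrightarrow> 0 < ks ! j" "(\<Sum>j<r. ks ! j) = 2 * M + 1"
      "odd (ks ! \<alpha>)" "\<And>j. j < r \<Longrightarrow> j \<noteq> \<alpha> \<Longrightarrow> even (ks ! j)"
      unfolding one_odd_indices_iff[OF \<alpha>] by auto
    let ?ls = "map (\<lambda>k. k div 2) ks"
    have d: "2 * ?ls ! j + of_bool (j = \<alpha>) = ks ! j" if "j < r" for j
      using ks(1) ks(4) ks(5)[OF that] that by (cases "j = \<alpha>") auto
    show "map (\<lambda>j. 2 * ?ls ! j + of_bool (j = \<alpha>)) [0..<r] = ks"
      by (rule nth_equalityI) (use d ks in auto)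
    have "2 * M + 1 = (\<Sum>j<r. 2 * ?ls ! j + of_bool (j = \<alpha>))"
      using d ks(3) by simp
    also have "\<dots> = 2 * (\<Sum>j<r. ?ls ! j) + 1"
      using \<alpha> by (simp add: sum.distrib sum_distrib_left[symmetric] of_bool_def)
    finally have "(\<Sum>j<r. ?ls ! j) = M" by simp
    moreover have "0 < ?ls ! j" if "j < r" "j \<noteq> \<alpha>" for j
      using d[OF that(1)] ks(2)[OF that(1)] that(2) by (cases "?ls ! j") auto
    ultimately show "?ls \<in> L" using ks(1) by (simp add: L_def)
  qed
  finally show ?thesis by (rule sym)
qed


section \<open>The sum over all indices modulo a prime\<close>

context half_prime
begin

text \<open>
  The product over all \<open>m \<le> N\<close> splits into the parts \<open>m < n\<close>, \<open>m = n\<close> and \<open>m > n\<close>, and each part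
  clears the denominators of one factor of the summand.
\<close>
lemma generating_series_mult:
  "(\<Sum>n=1..N. elem_sym (\<lambda>m. even_series (inv_mod m)) \<alpha> {1..<n} * odd_series (inv_mod n) *
        elem_sym (\<lambda>m. even_series (inv_mod m)) \<beta> {n<..N}) * fps_of_poly (recip_poly {1..N})
   = (\<Sum>n=1..N. fps_const (inv_mod n) *
       Abs_fps (\<lambda>u. (-1) ^ \<alpha> * of_nat (u choose \<alpha>) * coeff (recip_poly {1..<n}) u) *
       Abs_fps (\<lambda>u. (-1) ^ \<beta> * of_nat (u choose \<beta>) * coeff (recip_poly {n<..N}) u))"
  unfolding sum_distrib_right
proof (intro sum.cong refl)
  fix n assume n: "n \<in> {1..N}"
  have split: "recip_poly {1..N} = [:1, - ((inv_mod n)\<^sup>2):] * (recip_poly {1..<n} * recip_poly {n<..N})"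
  proof -
    have "{1..N} = insert n ({1..<n} \<union> {n<..N})" using n by auto
    then have "recip_poly {1..N} = [:1, - ((inv_mod n)\<^sup>2):] * recip_poly ({1..<n} \<union> {n<..N})"
      unfolding recip_poly_def by simp
    also have "recip_poly ({1..<n} \<union> {n<..N}) = recip_poly {1..<n} * recip_poly {n<..N}"
      unfolding recip_poly_def by (rule prod.union_disjoint) auto
    finally show ?thesis .
  qed
  let ?f = "\<lambda>m. even_series (inv_mod m)"
  have "elem_sym ?f \<alpha> {1..<n} * odd_series (inv_mod n) * elem_sym ?f \<beta> {n<..N} * fps_of_poly (recip_poly {1..N})
    = (fps_of_poly [:1, - ((inv_mod n)\<^sup>2):] * odd_series (inv_mod n)) * (elem_sym ?f \<alpha> {1..<n} * fps_of_poly (recip_poly {1..<n})) *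
      (elem_sym ?f \<beta> {n<..N} * fps_of_poly (recip_poly {n<..N}))"
    unfolding split fps_of_poly_mult by (simp only: mult_ac)
  then show "elem_sym ?f \<alpha> {1..<n} * odd_series (inv_mod n) * elem_sym ?f \<beta> {n<..N} * fps_of_poly (recip_poly {1..N})
    = fps_const (inv_mod n) *
       Abs_fps (\<lambda>u. (-1) ^ \<alpha> * of_nat (u choose \<alpha>) * coeff (recip_poly {1..<n}) u) *
       Abs_fps (\<lambda>u. (-1) ^ \<beta> * of_nat (u choose \<beta>) * coeff (recip_poly {n<..N}) u)"
    unfolding odd_series_mult recip_poly_def by (simp only: elem_sym_even_series finite_atLeastLessThan finite_greaterThanAtMost)
qed

lemma coeff_mult_recip_poly_full:
  assumes "M < N"
  shows "[(T * fps_of_poly (recip_poly {1..N})) $ M = T $ M] (mod int p)"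
proof -
  have "(T * fps_of_poly (recip_poly {1..N})) $ M = (\<Sum>i=0..M. T $ i * coeff (recip_poly {1..N}) (M - i))"
    by (simp add: fps_mult_nth)
  also have "[\<dots> = (\<Sum>i=0..M. if i = M then T $ i else 0)] (mod int p)"
  proof (rule cong_sum)
    fix i assume i: "i \<in> {0..M}"
    have "[T $ i * coeff (recip_poly {1..N}) (M - i) = T $ i * 0] (mod int p)" if "i \<noteq> M"
      by (intro cong_mult cong_refl coeff_recip_poly_full) (use i that assms in auto)
    then show "[T $ i * coeff (recip_poly {1..N}) (M - i) = (if i = M then T $ i else 0)] (mod int p)"
      by (simp add: coeff_recip_poly_0)
  qed
  finally show ?thesis by simp
qed

text \<open>
  For \<open>M < N\<close> the coefficient of \<open>X\<^sup>M\<close> in the generating series is unchanged modulo \<open>p\<close> by the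
  multiplication in \<open>generating_series_mult\<close>. The product has as coefficient a combination of the
  \<^const>\<open>mixed_sum\<close> values, which \<open>mixed_sum_cong\<close> evaluates.
\<close>
lemma sum_one_odd_cong:
  assumes M: "M < N"
  shows "[4 ^ M * (\<Sum>ks\<in>one_odd_indices (2 * M + 1) (\<alpha> + Suc \<beta>) (Suc \<alpha>).
            \<Sum>ns\<in>half_chains p (\<alpha> + Suc \<beta>). \<Prod>j<\<alpha> + Suc \<beta>. inv_mod (ns ! j) ^ (ks ! j))
      = (-1) ^ (\<alpha> + \<beta>) * (\<Sum>u\<le>M. int (u choose \<alpha>) * int ((M - u) choose \<beta>) * int ((2 * M + 1) choose (2 * (M - u)))) * odd_power_sum M]
      (mod int p)"
proof -
  let ?r = "\<alpha> + Suc \<beta>" and ?f = "\<lambda>m. even_series (inv_mod m)" and ?g = "\<lambda>m. odd_series (inv_mod m)"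
  define T where "T = (\<Sum>n=1..N. elem_sym ?f \<alpha> {1..<n} * ?g n * elem_sym ?f \<beta> {n<..N})"
  have "(\<Sum>ks\<in>one_odd_indices (2 * M + 1) ?r (Suc \<alpha>). \<Sum>ns\<in>half_chains p ?r. \<Prod>j<?r. inv_mod (ns ! j) ^ (ks ! j))
      = (\<Sum>ns\<in>half_chains p ?r. (\<Prod>j<?r. (if j = \<alpha> then odd_series else even_series) (inv_mod (ns ! j))) $ M)"
    by (subst sum.swap, intro sum.cong refl, rule sum_one_odd_indices) simp
  also have "\<dots> = (\<Sum>ns\<in>half_chains p ?r. \<Prod>j<?r. (if j = \<alpha> then ?g else ?f) (ns ! j)) $ M"
    by (simp add: fps_sum_nth if_distrib[of "\<lambda>f. f _"] cong: if_cong)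
  also have "\<dots> = T $ M"
    unfolding T_def by (subst sum_half_chains[OF p]) (rule refl)
  finally have 1: "(\<Sum>ks\<in>one_odd_indices (2 * M + 1) ?r (Suc \<alpha>). \<Sum>ns\<in>half_chains p ?r. \<Prod>j<?r. inv_mod (ns ! j) ^ (ks ! j)) = T $ M" .
  have "(T * fps_of_poly (recip_poly {1..N})) $ M =
     (\<Sum>n=1..N. \<Sum>u\<le>M. (-1) ^ (\<alpha> + \<beta>) * (int (u choose \<alpha>) * int ((M - u) choose \<beta>)) * (inv_mod n * coeff (recip_poly {1..<n}) u * coeff (recip_poly {n<..N}) (M - u)))"
    unfolding T_def generating_series_mult unfolding fps_sum_nth mult.assoc fps_mult_left_const_nth
    unfolding fps_mult_nth atMost_atLeast0 sum_distrib_left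
    by (intro sum.cong refl) (simp add: power_add mult_ac)
  also have "\<dots> = (\<Sum>u\<le>M. (-1) ^ (\<alpha> + \<beta>) * (int (u choose \<alpha>) * int ((M - u) choose \<beta>)) * mixed_sum u (M - u))"
    by (subst sum.swap) (simp add: mixed_sum_def sum_distrib_left)
  finally have 2: "4 ^ M * (T * fps_of_poly (recip_poly {1..N})) $ M =
     (\<Sum>u\<le>M. (-1) ^ (\<alpha> + \<beta>) * (int (u choose \<alpha>) * int ((M - u) choose \<beta>)) * (4 ^ M * mixed_sum u (M - u)))"
    by (simp add: sum_distrib_left mult_ac)
  have "[4 ^ M * T $ M = 4 ^ M * (T * fps_of_poly (recip_poly {1..N})) $ M] (mod int p)"
    by (intro cong_mult cong_refl cong_sym[OF coeff_mult_recip_poly_full[OF M]])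
  also have "[4 ^ M * (T * fps_of_poly (recip_poly {1..N})) $ M =
     (\<Sum>u\<le>M. (-1) ^ (\<alpha> + \<beta>) * (int (u choose \<alpha>) * int ((M - u) choose \<beta>)) * (int ((2 * M + 1) choose (2 * (M - u))) * odd_power_sum M))] (mod int p)"
    unfolding 2
  proof (intro cong_sum cong_mult[OF cong_refl])
    fix u assume "u \<in> {..M}"
    then have "u + (M - u) = M" by simp
    then show "[4 ^ M * mixed_sum u (M - u) = int ((2 * M + 1) choose (2 * (M - u))) * odd_power_sum M] (mod int p)"
      using mixed_sum_cong[of u "M - u"] M by simp
  qed
  also have "(\<Sum>u\<le>M. (-1) ^ (\<alpha> + \<beta>) * (int (u choose \<alpha>) * int ((M - u) choose \<beta>)) * (int ((2 * M + 1) choose (2 * (M - u))) * odd_power_sum M))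
     = (-1) ^ (\<alpha> + \<beta>) * (\<Sum>u\<le>M. int (u choose \<alpha>) * int ((M - u) choose \<beta>) * int ((2 * M + 1) choose (2 * (M - u)))) * odd_power_sum M"
    by (simp add: sum_distrib_left sum_distrib_right mult_ac)
  finally show ?thesis unfolding 1 .
qed

lemma residue_half_harmonic_sum_inv_mod:
  "[residue_rat p (half_harmonic_sum p ks) =
     (\<Sum>ns\<in>half_chains p (length ks). \<Prod>j<length ks. inv_mod (ns ! j) ^ (ks ! j))] (mod int p)"
proof -
  have "[modular_inverse (int p) (\<Prod>j<length ks. int (ns ! j) ^ (ks ! j)) = (\<Prod>j<length ks. inv_mod (ns ! j) ^ (ks ! j))] (mod int p)"
    if ns: "ns \<in> half_chains p (length ks)" for ns
  proof -
    let ?x = "\<Prod>j<length ks. int (ns ! j) ^ (ks ! j)"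
    have rng: "ns ! j \<in> {1..N}" if "j < length ks" for j
    proof -
      have "ns ! j \<in> set ns" using ns that by (simp add: half_chains_def)
      then have "0 < ns ! j \<and> 2 * (ns ! j) < p" using ns by (auto simp: half_chains_def)
      then show ?thesis using p by auto
    qed
    have cop: "coprime ?x (int p)"
      using half_chains_not_dvd[OF prime ns] prime_int by (metis coprime_commute prime_imp_coprime)
    have "?x * (\<Prod>j<length ks. inv_mod (ns ! j) ^ (ks ! j)) = (\<Prod>j<length ks. (int (ns ! j) * inv_mod (ns ! j)) ^ (ks ! j))"
      by (simp add: prod.distrib power_mult_distrib)
    also have "[\<dots> = (\<Prod>j<length ks. 1 ^ (ks ! j))] (mod int p)"
      by (intro cong_prod cong_pow inv_mod_mult) (use rng in auto)
    finally have "[?x * modular_inverse (int p) ?x = ?x * (\<Prod>j<length ks. inv_mod (ns ! j) ^ (ks ! j))] (mod int p)"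
      using cong_modular_inverse1[OF cop] by (simp add: cong_def)
    then show ?thesis using cop by (simp only: cong_mult_lcancel)
  qed
  then show ?thesis
    by (intro cong_trans[OF residue_half_harmonic_sum(2)[OF prime]] cong_sum)
qed

lemma residue_single:
  assumes M: "M < N"
  shows "[residue_rat p (half_harmonic_sum p [2 * M + 1]) = odd_power_sum M] (mod int p)"
proof -
  have "(\<Sum>ns\<in>half_chains p 1. inv_mod (ns ! 0) ^ (2 * M + 1)) = (\<Sum>n=1..N. inv_mod n ^ (2 * M + 1))"
    by (rule sum.reindex_bij_witness[of _ "\<lambda>n. [n]" "\<lambda>ns. ns ! 0"])
       (use p in \<open>auto simp: half_chains_def length_Suc_conv\<close>)
  also have "[\<dots> = odd_power_sum M] (mod int p)"
    unfolding odd_power_sum_def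
  proof (rule cong_sum)
    fix n assume n: "n \<in> {1..N}"
    have cop: "coprime (int n ^ (2 * M + 1)) (int p)"
      using coprime_small[of "int n"] n p by simp
    have nd: "\<not> int p dvd int n" using not_dvd_small[of "int n"] n p by simp
    have "int n ^ (2 * M + 1) * int n ^ (2 * (N - Suc M) + 1) = int n ^ (2 * N)"
      unfolding power_add[symmetric] using M by (intro arg_cong2[of _ _ _ _ power]) auto
    moreover have "[(int n * inv_mod n) ^ (2 * M + 1) = 1 ^ (2 * M + 1)] (mod int p)"
      by (intro cong_pow inv_mod_mult n)
    ultimately have "[int n ^ (2 * M + 1) * inv_mod n ^ (2 * M + 1) = int n ^ (2 * M + 1) * int n ^ (2 * (N - Suc M) + 1)] (mod int p)"
      using fermat[OF nd] by (simp only: power_mult_distrib power_one cong_def)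
    then show "[inv_mod n ^ (2 * M + 1) = int n ^ (2 * (N - Suc M) + 1)] (mod int p)"
      using cop by (simp only: cong_mult_lcancel)
  qed
  finally show ?thesis
    using residue_half_harmonic_sum_inv_mod[of "[2 * M + 1]"] by (simp add: cong_def)
qed

text \<open>
  After multiplication by \<open>4\<^sup>M\<close>, which is invertible modulo \<open>p\<close>, the constant becomes the integer
  that \<open>sum_one_odd_cong\<close> provides.
\<close>
lemma residue_identity:
  assumes M: "M < N" and \<alpha>\<beta>: "\<alpha> + \<beta> \<le> M"
  shows "[(\<Sum>ks\<in>one_odd_indices (2 * M + 1) (\<alpha> + \<beta> + 1) (\<alpha> + 1). residue_rat p (half_harmonic_sum p ks))
    = residue_rat p (C_const (2 * M + 1) (\<alpha> + \<beta> + 1) (\<alpha> + 1)) * residue_rat p (half_harmonic_sum p [2 * M + 1])] (mod int p)"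
    (is "[?S = residue_rat p ?C * ?z] (mod _)")
proof -
  define a :: int where "a = (-1) ^ (\<alpha> + \<beta>) * (\<Sum>u\<le>M. int (u choose \<alpha>) * int ((M - u) choose \<beta>) * int ((2 * M + 1) choose (2 * (M - u))))"
  have cop: "coprime (4 ^ M) (int p)"
    using coprime_two coprime_power_left_iff[of 2 "2 * M" "int p"] by (simp add: power_mult)
  have nd: "\<not> int p dvd 4 ^ M"
    using cop prime_int by (metis coprime_absorb_right not_prime_unit)
  have "?C * of_int (4 ^ M) = of_int a"
    using C_const_eq_sum[OF \<alpha>\<beta>] by (simp add: a_def)
  then have C: "[4 ^ M * residue_rat p ?C = a] (mod int p)"
    by (rule integral_at_fraction(2)[OF prime nd])
  have "[?S = (\<Sum>ks\<in>one_odd_indices (2 * M + 1) (\<alpha> + \<beta> + 1) (\<alpha> + 1).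
            \<Sum>ns\<in>half_chains p (\<alpha> + Suc \<beta>). \<Prod>j<\<alpha> + Suc \<beta>. inv_mod (ns ! j) ^ (ks ! j))] (mod int p)"
  proof (rule cong_sum)
    fix ks assume "ks \<in> one_odd_indices (2 * M + 1) (\<alpha> + \<beta> + 1) (\<alpha> + 1)"
    then have "length ks = \<alpha> + Suc \<beta>" by (simp add: one_odd_indices_def)
    then show "[residue_rat p (half_harmonic_sum p ks) = (\<Sum>ns\<in>half_chains p (\<alpha> + Suc \<beta>). \<Prod>j<\<alpha> + Suc \<beta>. inv_mod (ns ! j) ^ (ks ! j))] (mod int p)"
      using residue_half_harmonic_sum_inv_mod[of ks] by simp
  qed
  then have "[4 ^ M * ?S = 4 ^ M * (\<Sum>ks\<in>one_odd_indices (2 * M + 1) (\<alpha> + \<beta> + 1) (\<alpha> + 1).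
            \<Sum>ns\<in>half_chains p (\<alpha> + Suc \<beta>). \<Prod>j<\<alpha> + Suc \<beta>. inv_mod (ns ! j) ^ (ks ! j))] (mod int p)"
    by (rule cong_scalar_left)
  also have "[4 ^ M * (\<Sum>ks\<in>one_odd_indices (2 * M + 1) (\<alpha> + \<beta> + 1) (\<alpha> + 1).
            \<Sum>ns\<in>half_chains p (\<alpha> + Suc \<beta>). \<Prod>j<\<alpha> + Suc \<beta>. inv_mod (ns ! j) ^ (ks ! j)) = a * odd_power_sum M] (mod int p)"
    using sum_one_odd_cong[OF M, of \<alpha> \<beta>] by (simp only: a_def add_Suc_right Suc_eq_plus1 add.assoc)
  also have "[a * odd_power_sum M = 4 ^ M * residue_rat p ?C * ?z] (mod int p)"
    by (intro cong_mult cong_sym[OF C] cong_sym[OF residue_single[OF M]])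
  finally have "[4 ^ M * ?S = 4 ^ M * (residue_rat p ?C * ?z)] (mod int p)"
    by (simp only: mult.assoc)
  then show ?thesis using cop by (simp only: cong_mult_lcancel)
qed

end


section \<open>The identity in the ring of residues modulo almost all primes\<close>

text \<open>Addition in the quotient is addition of representing families, so a finite sum is computed entrywise.\<close>
lemma sum_zeta_A2:
  assumes "finite S"
  shows "(\<Sum>ks\<in>S. zeta_A2 ks) = abs_ring_A (\<lambda>p. \<Sum>ks\<in>S. residue_rat p (half_harmonic_sum p ks))"
  using assms
proof (induction S rule: finite_induct)
  case empty
  then show ?case by (simp add: zero_ring_A_def)
next
  case (insert ks S)
  then show ?case
    by (simp add: zeta_A2.abs_eq plus_ring_A.abs_eq cong_almost_all_primes_refl)
qed

text \<open>The bound \<open>p > 2M + 2 = k + 1\<close> excludes finitely many primes and gives \<open>M < N\<close>.\<close>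
theorem theorem1p1:
  fixes k r i :: nat
  assumes "r \<ge> 1" and "odd k" and "k \<ge> 2 * r - 1" and "1 \<le> i" and "i \<le> r"
  shows "(\<Sum>ks\<in>one_odd_indices k r i. zeta_A2 ks) = rat_A (C_const k r i) * zeta_A2 [k]"
proof -
  obtain M where k: "k = 2 * M + 1" using \<open>odd k\<close> by (rule oddE)
  define \<alpha> \<beta> where "\<alpha> = i - 1" and "\<beta> = r - i"
  have ri: "r = \<alpha> + \<beta> + 1" "i = \<alpha> + 1" using assms(4,5) by (auto simp: \<alpha>_def \<beta>_def)
  have \<alpha>\<beta>: "\<alpha> + \<beta> \<le> M" using assms(3) k ri by simp
  have "cong_almost_all_primes (\<lambda>p. \<Sum>ks\<in>one_odd_indices k r i. residue_rat p (half_harmonic_sum p ks))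
     (\<lambda>p. residue_rat p (C_const k r i) * residue_rat p (half_harmonic_sum p [k]))"
  proof (rule cong_almost_all_primesI)
    show "finite {p. prime p \<and> \<not> 2 * M + 2 < p}"
      by (rule finite_subset[of _ "{..2 * M + 2}"]) auto
    fix p :: nat assume pr: "prime p" "2 * M + 2 < p"
    then have "odd p" using prime_odd_nat by auto
    then obtain N where N: "p = 2 * N + 1" by (rule oddE)
    interpret half_prime p N using pr N by unfold_locales
    show "[(\<Sum>ks\<in>one_odd_indices k r i. residue_rat p (half_harmonic_sum p ks))
      = residue_rat p (C_const k r i) * residue_rat p (half_harmonic_sum p [k])] (mod int p)"
      unfolding k ri by (rule residue_identity) (use pr N \<alpha>\<beta> in auto)
  qed
  then show ?thesis
    unfolding sum_zeta_A2[OF finite_one_odd_indices]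
    by (simp add: rat_A.abs_eq zeta_A2.abs_eq times_ring_A.abs_eq cong_almost_all_primes_refl ring_A.abs_eq_iff)
qed

end
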